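(* Let $H$ be a nonzero complex Hilbert space and let $T \in \overline{\mathcal{AN}(H)}$ be normal. Then there exist $(H_n, U_n)_{n \in \mathbb{N}}$, where for all $n\in\mathbb{N}$, $H_n$ is a reducing subspace for $T$ and $U_n \in \mathcal{B}(H_n)$ is a unitary operator, and $\lambda_n \in \sigma(|T|)$ for all $n \in \mathbb{N}$, such that (1) $H = \bigoplus_{n\in \mathbb{N}}H_n$; (2) $T = \bigoplus_{n \in \mathbb{N}}\lambda_n U_n$.
   Context: $\mathcal{B}(H)$ is the space of bounded linear operators on $H$ with the operator norm. An operator is norm attaining if its norm is attained at some unit vector of its domain. $T\in\mathcal{B}(H)$ is absolutely norm attaining (an $\mathcal{AN}$-operator) if for every nonzero closed subspace $M$ of $H$ the restriction $T|_M:M\to H$ is norm attaining. $\mathcal{AN}(H)$ is the set of such operators, and $\overline{\mathcal{AN}(H)}$ its closure in the operator norm. $T$ is normal if $T^*T=TT^*$; $|T|=(T^*T)^{1/2}$; $\sigma(\cdot)$ is the spectrum. Direct sums of Hilbert spaces are orthogonal Hilbert space direct sums, the summands $H_n$ being closed subspaces of $H$ (possibly zero), and $\left(\bigoplus_n T_n\right)(x_1,x_2,\dots)=(T_1x_1,T_2x_2,\dots)$. *)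

theory Defs
  imports "HOL-Analysis.Analysis"
begin

text \<open>
  Complex inner product spaces, linear in the first argument. The underlying real inner product
  is the real part of the complex one, so that \<^const>\<open>norm\<close> and the topology, inherited from
  \<^class>\<open>real_inner\<close>, are the usual ones: the norm of \<open>x\<close> is the square root of \<open>cinner x x\<close>.
  Definiteness of \<open>cinner\<close> is definiteness of \<^const>\<open>inner\<close>.
\<close>

class complex_inner = real_inner +
  fixes scaleC :: "complex \<Rightarrow> 'a \<Rightarrow> 'a"  (infixr \<open>*\<^sub>C\<close> 75)
    and cinner :: "'a \<Rightarrow> 'a \<Rightarrow> complex"
  assumes scaleC_add_right: "c *\<^sub>C (x + y) = c *\<^sub>C x + c *\<^sub>C y"
    and scaleC_add_left: "(c + d) *\<^sub>C x = c *\<^sub>C x + d *\<^sub>C x"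
    and scaleC_scaleC: "c *\<^sub>C d *\<^sub>C x = (c * d) *\<^sub>C x"
    and scaleC_one: "1 *\<^sub>C x = x"
    and scaleR_scaleC: "r *\<^sub>R x = complex_of_real r *\<^sub>C x"
    and cinner_commute: "cinner x y = cnj (cinner y x)"
    and cinner_add_left: "cinner (x + y) z = cinner x z + cinner y z"
    and cinner_scaleC_left: "cinner (c *\<^sub>C x) y = c * cinner x y"
    and inner_eq_Re_cinner: "inner x y = Re (cinner x y)"

class complex_hilbert = complex_inner + banach

interpretation complex_vector: vector_space "scaleC :: complex \<Rightarrow> 'a \<Rightarrow> 'a::complex_inner"
  by unfold_locales (simp_all add: scaleC_add_right scaleC_add_left scaleC_scaleC scaleC_one)

definition closed_csubspace :: "'a::complex_inner set \<Rightarrow> bool" where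
  "closed_csubspace M \<longleftrightarrow> complex_vector.subspace M \<and> closed M"

definition corthogonal_complement :: "'a::complex_inner set \<Rightarrow> 'a set" where
  "corthogonal_complement M = {x. \<forall>y\<in>M. cinner x y = 0}"

text \<open>
  The elements of \<open>'a \<Rightarrow>\<^sub>L 'a\<close> are the bounded real-linear maps; the bounded operators of the
  complex space are the complex-linear ones among them. They form a norm-closed set, and the norm
  of \<open>'a \<Rightarrow>\<^sub>L 'a\<close> is the operator norm.
\<close>

definition bounded_ops :: "('a::complex_inner \<Rightarrow>\<^sub>L 'a) set" where
  "bounded_ops = {T :: 'a \<Rightarrow>\<^sub>L 'a. \<forall>c x. T (c *\<^sub>C x) = c *\<^sub>C T x}"

definition restriction_norm :: "('a::complex_inner \<Rightarrow>\<^sub>L 'a) \<Rightarrow> 'a set \<Rightarrow> real" where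
  "restriction_norm T M = (SUP x\<in>{x\<in>M. norm x = 1}. norm (T x))"

definition norm_attaining_on :: "('a::complex_inner \<Rightarrow>\<^sub>L 'a) \<Rightarrow> 'a set \<Rightarrow> bool" where
  "norm_attaining_on T M \<longleftrightarrow> (\<exists>x\<in>M. norm x = 1 \<and> norm (T x) = restriction_norm T M)"

definition AN_ops :: "('a::complex_inner \<Rightarrow>\<^sub>L 'a) set" where
  "AN_ops = {T\<in>bounded_ops.
     \<forall>M. closed_csubspace M \<and> M \<noteq> {0} \<longrightarrow> norm_attaining_on T M}"

text \<open>
  On a complex Hilbert space the adjoint of an operator in \<open>bounded_ops\<close> and the positive square
  root in \<open>abs_op\<close> exist and are unique, so the descriptions are proper.
\<close>

definition cadjoint :: "('a::complex_hilbert \<Rightarrow>\<^sub>L 'a) \<Rightarrow> 'a \<Rightarrow>\<^sub>L 'a" where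
  "cadjoint T = (THE S. S \<in> bounded_ops \<and> (\<forall>x y. cinner (T x) y = cinner x (S y)))"

definition normal_op :: "('a::complex_hilbert \<Rightarrow>\<^sub>L 'a) \<Rightarrow> bool" where
  "normal_op T \<longleftrightarrow> cadjoint T o\<^sub>L T = T o\<^sub>L cadjoint T"

definition positive_op :: "('a::complex_hilbert \<Rightarrow>\<^sub>L 'a) \<Rightarrow> bool" where
  "positive_op S \<longleftrightarrow> S \<in> bounded_ops \<and> (\<forall>x. cinner (S x) x \<in> \<real> \<and> 0 \<le> Re (cinner (S x) x))"

definition abs_op :: "('a::complex_hilbert \<Rightarrow>\<^sub>L 'a) \<Rightarrow> 'a \<Rightarrow>\<^sub>L 'a" where
  "abs_op T = (THE S. positive_op S \<and> S o\<^sub>L S = cadjoint T o\<^sub>L T)"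

text \<open>The operator \<open>R\<close> is a bounded two-sided inverse of \<open>T - \<mu>I\<close>.\<close>

definition op_spectrum :: "('a::complex_hilbert \<Rightarrow>\<^sub>L 'a) \<Rightarrow> complex set" where
  "op_spectrum T = {\<mu>. \<not> (\<exists>R\<in>bounded_ops. \<forall>x.
     R (T x - \<mu> *\<^sub>C x) = x \<and> T (R x) - \<mu> *\<^sub>C R x = x)}"

definition reducing_subspace :: "('a::complex_hilbert \<Rightarrow>\<^sub>L 'a) \<Rightarrow> 'a set \<Rightarrow> bool" where
  "reducing_subspace T M \<longleftrightarrow> closed_csubspace M \<and> blinfun_apply T ` M \<subseteq> M \<and>
     blinfun_apply T ` corthogonal_complement M \<subseteq> corthogonal_complement M"

text \<open>
  Operators on a subspace \<open>M\<close> are functions on the whole type of which only the values on \<open>M\<close>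
  matter.
\<close>

definition bounded_op_on :: "'a::complex_inner set \<Rightarrow> ('a \<Rightarrow> 'a) \<Rightarrow> bool" where
  "bounded_op_on M U \<longleftrightarrow> U ` M \<subseteq> M \<and>
     (\<forall>x\<in>M. \<forall>y\<in>M. U (x + y) = U x + U y) \<and>
     (\<forall>c. \<forall>x\<in>M. U (c *\<^sub>C x) = c *\<^sub>C U x) \<and>
     (\<exists>K. \<forall>x\<in>M. norm (U x) \<le> K * norm x)"

text \<open>Here \<open>V\<close> is the adjoint of \<open>U\<close> as an operator on \<open>M\<close>.\<close>

definition unitary_on :: "'a::complex_inner set \<Rightarrow> ('a \<Rightarrow> 'a) \<Rightarrow> bool" where
  "unitary_on M U \<longleftrightarrow> bounded_op_on M U \<and>
     (\<exists>V. bounded_op_on M V \<and>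
        (\<forall>x\<in>M. \<forall>y\<in>M. cinner (U x) y = cinner x (V y)) \<and>
        (\<forall>x\<in>M. V (U x) = x \<and> U (V x) = x))"

text \<open>
  Internal orthogonal direct sums: \<open>x\<close> is identified with the sequence of its components, the
  unique \<open>y\<close> with \<open>y n \<in> H n\<close> and sum \<open>x\<close>. By orthogonality the series of \<open>y\<close> converges iff
  the squares of its norms are summable.
\<close>

definition orthogonal_direct_sum :: "(nat \<Rightarrow> 'a::complex_hilbert set) \<Rightarrow> bool" where
  "orthogonal_direct_sum H \<longleftrightarrow> (\<forall>n. closed_csubspace (H n)) \<and>
     (\<forall>m n. m \<noteq> n \<longrightarrow> (\<forall>x\<in>H m. \<forall>y\<in>H n. cinner x y = 0)) \<and>
     (\<forall>x. \<exists>y. (\<forall>n. y n \<in> H n) \<and> y sums x)"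

definition is_direct_sum_op ::
    "('a::complex_hilbert \<Rightarrow>\<^sub>L 'a) \<Rightarrow> (nat \<Rightarrow> 'a set) \<Rightarrow> (nat \<Rightarrow> 'a \<Rightarrow> 'a) \<Rightarrow> bool" where
  "is_direct_sum_op T H S \<longleftrightarrow>
     (\<forall>x y. (\<forall>n. y n \<in> H n) \<and> y sums x \<longrightarrow> (\<lambda>n. S n (y n)) sums T x)"

end

theory Submission
  imports Defs
begin

text \<open>
  If \<open>T\<close> is a norm limit of absolutely norm attaining operators, then \<open>\<parallel>T e\<parallel>\<close> cannot stay below \<open>a\<close> for
  some unit vectors \<open>e\<close> and above \<open>b > a\<close> for others, both arbitrarily far out (orthogonal to any given
  finite set): an approximating operator would have a closed subspace on which its norm is not
  attained. So there is an \<open>\<alpha>\<close> such that \<open>\<parallel>T e\<parallel>\<^sup>2\<close> is close to \<open>\<alpha>\<close> far out, that is, \<open>T\<^sup>*T - \<alpha>I\<close> is compact,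
  and \<open>H\<close> is the orthogonal sum of the countably many eigenspaces of \<open>T\<^sup>*T\<close>. By normality these reduce
  \<open>T\<close>, and on the eigenspace of \<open>\<lambda>\<^sup>2\<close> with \<open>\<lambda> > 0\<close> the operator \<open>T / \<lambda>\<close> is unitary.
\<close>

section \<open>Real Hilbert spaces\<close>

text \<open>Far out means orthogonal to a finite set for the real inner product; this takes the
  place of weak convergence. The spectral argument treats \<open>T\<^sup>*T\<close> as a symmetric
  map of the underlying real Hilbert space, and complex orthogonality is obtained where needed by
  listing \<open>\<i> *\<^sub>C f\<close> next to \<open>f\<close>. The number \<alpha> is the
  square of the best lower bound \<open>s\<close> for \<open>\<parallel>T e\<parallel>\<close> far
  out; since values below and above a gap cannot both persist, \<open>s\<close> is also the upper
  bound there, up to any positive error. Two obstacles shape the end. The operator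
  \<open>abs_op T\<close> is a definite description, so it has to be computed: on an eigenspace of
  \<open>T\<^sup>*T\<close> every positive square root is forced to be multiplication by the root of
  the eigenvalue. And the sum runs over all natural numbers although there may be only finitely many
  eigenvalues. The surplus summands are {0}, but their \<lambda> must still lie in the spectrum; it
  is borrowed from a nonzero summand, which exists because the space is nonzero.\<close>

lemma Cauchy_if_norm_diff_sq_le:
  fixes x :: "nat \<Rightarrow> 'a::real_normed_vector"
  assumes "t \<longlonglongrightarrow> 0" and le: "\<And>m n. (norm (x m - x n))\<^sup>2 \<le> t m + t n"
  shows "Cauchy x"
proof (rule metric_CauchyI)
  fix e :: real assume "e > 0"
  then have "\<forall>\<^sub>F n in sequentially. t n < e\<^sup>2 / 2"
    using order_tendstoD(2)[OF assms(1), of "e\<^sup>2 / 2"] by simp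
  then obtain N where N: "\<And>n. n \<ge> N \<Longrightarrow> t n < e\<^sup>2 / 2"
    by (auto simp: eventually_sequentially)
  show "\<exists>N. \<forall>m\<ge>N. \<forall>n\<ge>N. dist (x m) (x n) < e"
  proof (intro exI allI impI)
    fix m n assume "m \<ge> N" "n \<ge> N"
    then have "(norm (x m - x n))\<^sup>2 < e\<^sup>2"
      using le[of m n] N[of m] N[of n] by linarith
    then show "dist (x m) (x n) < e"
      using \<open>e > 0\<close> by (simp add: dist_norm power2_less_imp_less)
  qed
qed

text \<open>The representing vector minimises \<open>\<parallel>y\<parallel>\<^sup>2 - 2 f y\<close> over \<open>M\<close>.\<close>

lemma riesz_closed_subspace:
  fixes f :: "'a::{real_inner, banach} \<Rightarrow> real"
  assumes M: "subspace M" "closed M" and f: "bounded_linear f"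
  obtains m where "m \<in> M" "\<And>y. y \<in> M \<Longrightarrow> f y = inner m y"
proof -
  interpret f: bounded_linear f by (fact f)
  define J where "J y = (norm y)\<^sup>2 - 2 * f y" for y
  obtain C where C: "\<And>y. \<bar>f y\<bar> \<le> norm y * C"
    using f.bounded by auto
  have "- C\<^sup>2 \<le> J y" for y
  proof -
    have "0 \<le> (norm y - C)\<^sup>2" by simp
    also have "\<dots> = (norm y)\<^sup>2 - 2 * (norm y * C) + C\<^sup>2"
      by (simp add: power2_diff)
    also have "\<dots> \<le> J y + C\<^sup>2" using C[of y] by (simp add: J_def)
    finally show ?thesis by simp
  qed
  then have bdd: "bdd_below (J ` M)" by (rule bdd_belowI2)
  have ne: "J ` M \<noteq> {}" using subspace_0[OF M(1)] by auto
  define I where "I = Inf (J ` M)"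
  have I_le: "I \<le> J y" if "y \<in> M" for y
    unfolding I_def using bdd that by (simp add: cINF_lower)
  have "\<exists>y\<in>M. J y < I + inverse (real (Suc n))" for n
    using cInf_lessD[OF ne, of "I + inverse (real (Suc n))"] by (auto simp: I_def)
  then obtain y where yM: "\<And>n. y n \<in> M" and yJ: "\<And>n. J (y n) < I + inverse (real (Suc n))"
    by metis
  have "(norm (y m - y n))\<^sup>2 \<le> 2 * inverse (real (Suc m)) + 2 * inverse (real (Suc n))" for m n
  proof -
    define z where "z = (1/2) *\<^sub>R (y m + y n)"
    have "I \<le> J z" using yM M(1) by (auto intro!: I_le simp: z_def subspace_add subspace_scale)
    \<comment> \<open>Parallelogram law. The linear terms cancel because \<open>z\<close> is the
      midpoint, so two near-minimisers of \<open>J\<close> are close.\<close>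
    moreover have "(norm (y m - y n))\<^sup>2 = 2 * J (y m) + 2 * J (y n) - 4 * J z"
      unfolding J_def z_def f.scaleR f.add power2_norm_eq_inner
      by (simp add: inner_add_left inner_add_right inner_diff_left inner_diff_right
          inner_commute field_simps)
    ultimately show ?thesis using yJ[of m] yJ[of n] by simp
  qed
  moreover have "(\<lambda>n. 2 * inverse (real (Suc n))) \<longlonglongrightarrow> 0"
    by (intro tendsto_mult_right_zero LIMSEQ_inverse_real_of_nat)
  ultimately have "Cauchy y" by (rule Cauchy_if_norm_diff_sq_le[rotated])
  then obtain m where lim: "y \<longlonglongrightarrow> m" using Cauchy_convergent convergent_def by blast
  have mM: "m \<in> M" using closed_sequentially[OF M(2)] yM lim by blast
  have "(\<lambda>n. J (y n)) \<longlonglongrightarrow> J m"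
    unfolding J_def by (intro tendsto_intros f.tendsto lim)
  moreover have "(\<lambda>n. I + inverse (real (Suc n))) \<longlonglongrightarrow> I"
    by (rule LIMSEQ_inverse_real_of_nat_add)
  ultimately have "J m \<le> I"
    by (rule LIMSEQ_le) (use yJ less_imp_le in blast)
  have min: "J m \<le> J (m + s *\<^sub>R y)" if "y \<in> M" for s y
    using \<open>J m \<le> I\<close> I_le[of "m + s *\<^sub>R y"] mM that M(1)
    by (simp add: subspace_add subspace_scale)
  have "f y = inner m y" if y: "y \<in> M" for y
  proof (rule ccontr)
    assume ne: "f y \<noteq> inner m y"
    define a where "a = f y - inner m y"
    have "y \<noteq> 0" using ne by (auto simp: f.zero)
    \<comment> \<open>The minimiser of the quadratic \<open>J (m + s *\<^sub>R y)\<close> in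
      \<open>s\<close>; its value there is \<open>a\<^sup>2 / (norm y)\<^sup>2\<close> below
      \<open>J m\<close>.\<close>
    define s where "s = a / (norm y)\<^sup>2"
    have "J (m + s *\<^sub>R y) = J m - 2 * s * a + s\<^sup>2 * (norm y)\<^sup>2"
      unfolding J_def a_def f.add f.scaleR power2_norm_eq_inner
      by (simp add: inner_add_left inner_add_right inner_commute algebra_simps power2_eq_square)
    also have "\<dots> = J m - a\<^sup>2 / (norm y)\<^sup>2"
      using \<open>y \<noteq> 0\<close> by (simp add: s_def field_simps power2_eq_square)
    also have "\<dots> < J m" using ne \<open>y \<noteq> 0\<close> by (simp add: a_def)
    finally show False using min[OF y, of s] by simp
  qed
  then show thesis using that mM by blast
qed

lemma orthogonal_projection_exists:
  fixes x :: "'a::{real_inner, banach}"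
  assumes "subspace M" "closed M"
  shows "\<exists>p\<in>M. \<forall>y\<in>M. inner (x - p) y = 0"
proof -
  obtain p where "p \<in> M" "\<And>y. y \<in> M \<Longrightarrow> inner x y = inner p y"
    using riesz_closed_subspace[OF assms bounded_linear_inner_right[of x]] by blast
  then show ?thesis by (auto simp: inner_diff_left intro!: bexI[of _ p])
qed

text \<open>By Pythagoras the squared distance of two partial sums is a difference of partial sums
  of a convergent real series. Measured against the limit \<open>S\<close>, it splits into one null
  term for each index.\<close>

lemma summable_orthogonal:
  fixes y :: "nat \<Rightarrow> 'a::{real_inner, banach}"
  assumes orth: "\<And>m n. m \<noteq> n \<Longrightarrow> inner (y m) (y n) = 0"
    and sq: "summable (\<lambda>n. (norm (y n))\<^sup>2)"
  shows "summable y"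
proof -
  define s where "s n = (\<Sum>k<n. (norm (y k))\<^sup>2)" for n
  obtain S where lim: "s \<longlonglongrightarrow> S"
    using sq unfolding summable_def sums_def s_def by blast
  have *: "(norm ((\<Sum>k<m. y k) - (\<Sum>k<n. y k)))\<^sup>2 = s m - s n" if "n \<le> m" for m n
  proof -
    have d: "{..<m} - {..<n} = {n..<m}" using that by auto
    have "(\<Sum>k<m. y k) - (\<Sum>k<n. y k) = (\<Sum>k=n..<m. y k)"
      using that by (simp add: sum_diff[symmetric] d)
    moreover have "s m - s n = (\<Sum>k=n..<m. (norm (y k))\<^sup>2)"
      using that by (simp add: s_def sum_diff[symmetric] d)
    moreover have "(norm (\<Sum>k=n..<m. y k))\<^sup>2 = (\<Sum>k=n..<m. (norm (y k))\<^sup>2)"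
      by (rule norm_sum_Pythagorean) (auto simp: pairwise_def orthogonal_def orth)
    ultimately show ?thesis by simp
  qed
  have "Cauchy (\<lambda>n. \<Sum>k<n. y k)"
  proof (rule Cauchy_if_norm_diff_sq_le)
    show "(\<lambda>n. \<bar>s n - S\<bar>) \<longlonglongrightarrow> 0"
      using lim by (simp add: LIM_zero tendsto_rabs_zero)
    fix m n
    show "(norm ((\<Sum>k<m. y k) - (\<Sum>k<n. y k)))\<^sup>2 \<le> \<bar>s m - S\<bar> + \<bar>s n - S\<bar>"
    proof (cases "n \<le> m")
      case True then show ?thesis using *[of n m] by linarith
    next
      case False then show ?thesis using *[of m n]
        by (subst norm_minus_commute) linarith
    qed
  qed
  then show ?thesis
    by (simp add: summable_iff_convergent Cauchy_convergent)
qed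

lemma norm_sq_sums_orthogonal:
  fixes y :: "nat \<Rightarrow> 'a::real_inner"
  assumes orth: "\<And>m n. m \<noteq> n \<Longrightarrow> inner (y m) (y n) = 0" and "y sums x"
  shows "(\<lambda>n. (norm (y n))\<^sup>2) sums (norm x)\<^sup>2"
proof -
  have "(\<Sum>k<n. (norm (y k))\<^sup>2) = (norm (\<Sum>k<n. y k))\<^sup>2" for n
    by (rule norm_sum_Pythagorean[symmetric]) (auto simp: pairwise_def orthogonal_def orth)
  then show ?thesis
    using assms(2) unfolding sums_def by (auto intro!: tendsto_intros)
qed

lemma inner_orthogonal_series:
  fixes y :: "nat \<Rightarrow> 'a::real_inner"
  assumes "\<And>m. m \<noteq> n \<Longrightarrow> inner (y m) w = 0" and "y sums x"
  shows "inner x w = inner (y n) w"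
proof -
  have "(\<lambda>m. inner (y m) w) sums inner x w"
    using bounded_linear.sums[OF bounded_linear_inner_left assms(2)] .
  moreover have "(\<lambda>m. inner (y m) w) sums inner (y n) w"
  proof -
    have "(\<lambda>m. inner (y m) w) = (\<lambda>m. if m = n then inner (y m) w else 0)"
      using assms(1) by auto
    then show ?thesis using sums_single[of n "\<lambda>m. inner (y m) w"] by simp
  qed
  ultimately show ?thesis using sums_unique2 by blast
qed

text \<open>Finite sets serve only through the vectors orthogonal to them, hence the implication
  between annihilators in place of a statement about spans. A vector already in the span of
  \<open>G\<close> adds nothing; otherwise its normalised remainder joins \<open>G\<close>.\<close>

lemma gram_schmidt_finite:
  fixes F :: "'a::real_inner set"
  assumes "finite F"
  shows "\<exists>G. finite G \<and> (\<forall>g\<in>G. \<forall>h\<in>G. inner g h = (if g = h then 1 else 0)) \<and>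
    (\<forall>x. (\<forall>g\<in>G. inner x g = 0) \<longrightarrow> (\<forall>f\<in>F. inner x f = 0))"
  using assms
proof induction
  case empty
  show ?case by (intro exI[of _ "{}"]) auto
next
  case (insert f F)
  from insert.IH obtain G where G: "finite G"
    "\<forall>g\<in>G. \<forall>h\<in>G. inner g h = (if g = h then 1 else 0)"
    "\<forall>x. (\<forall>g\<in>G. inner x g = 0) \<longrightarrow> (\<forall>f\<in>F. inner x f = 0)" by (elim exE conjE) (rule that)
  define p where "p = (\<Sum>g\<in>G. inner f g *\<^sub>R g)"
  define r where "r = f - p"
  have rG: "inner r g = 0" if "g \<in> G" for g
  proof -
    have "inner p g = (\<Sum>h\<in>G. if g = h then inner f h else 0)"
      unfolding p_def inner_sum_left using that G(2) by (intro sum.cong) auto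
    then show ?thesis using that G(1) by (simp add: r_def inner_diff_left)
  qed
  have pG: "inner x p = 0" if "\<forall>g\<in>G. inner x g = 0" for x
    using that by (simp add: p_def inner_sum_right)
  have fr: "f = r + p" by (simp add: r_def)
  show ?case
  proof (cases "r = 0")
    case True
    then show ?thesis using G pG fr by (intro exI[of _ G]) auto
  next
    case False
    have 1: "inner (sgn r) g = 0" "inner g (sgn r) = 0" if "g \<in> G" for g
      using rG[OF that] by (simp_all add: sgn_div_norm inner_commute)
    have 2: "inner (sgn r) (sgn r) = 1"
      using False by (simp add: dot_square_norm norm_sgn)
    have 3: "inner x f = 0" if "\<forall>g\<in>insert (sgn r) G. inner x g = 0" for x
    proof -
      have "inner x r = 0" using that False by (simp add: sgn_div_norm)
      then show ?thesis using pG[of x] that unfolding fr by (simp add: inner_add_right)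
    qed
    have 4: "g \<noteq> sgn r" if "g \<in> G" for g using 1(1)[OF that] 2 by auto
    show ?thesis
      using G 1 2 3 4 by (intro exI[of _ "insert (sgn r) G"]) (auto split: if_splits)
  qed
qed

text \<open>Bolzano-Weierstrass once for each member of \<open>G\<close>, passing to further
  subsequences. It stands in for weak compactness of balls: only finitely many coordinates have to
  settle.\<close>

lemma bounded_seq_finite_inner_convergent:
  fixes x :: "nat \<Rightarrow> 'a::real_inner"
  assumes "finite G" and "\<And>n. norm (x n) \<le> C"
  shows "\<exists>r. strict_mono (r :: nat \<Rightarrow> nat) \<and> (\<forall>g\<in>G. convergent (\<lambda>n. inner (x (r n)) g))"
  using assms(1)
proof induction
  case empty
  show ?case by (intro exI[of _ id]) (auto simp: strict_mono_def)
next
  case (insert g G)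
  then obtain r where r: "strict_mono r" "\<And>g. g \<in> G \<Longrightarrow> convergent (\<lambda>n. inner (x (r n)) g)"
    by blast
  have "\<bar>inner (x (r n)) g\<bar> \<le> C * norm g" for n
    using Cauchy_Schwarz_ineq2[of "x (r n)" g] assms(2)[of "r n"]
    by (meson dual_order.trans mult_right_mono norm_ge_zero)
  then have "bounded (range (\<lambda>n. inner (x (r n)) g))"
    by (auto simp: bounded_iff)
  then obtain l q where q: "strict_mono (q :: nat \<Rightarrow> nat)" "((\<lambda>n. inner (x (r n)) g) \<circ> q) \<longlonglongrightarrow> l"
    using bounded_imp_convergent_subsequence by blast
  have "convergent (\<lambda>n. inner (x (r (q n))) h)" if "h \<in> G" for h
    using convergent_subseq_convergent[OF r(2)[OF that] q(1)] by (simp add: o_def)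
  moreover have "convergent (\<lambda>n. inner (x (r (q n))) g)"
    using q(2) by (auto simp: o_def convergent_def)
  ultimately show ?case
    using strict_mono_o[OF r(1) q(1)] unfolding o_def
    by (intro exI[of _ "\<lambda>n. r (q n)"]) auto
qed

text \<open>For a symmetric map the quadratic form controls the norm: polarise at \<open>x\<close>
  and at the multiple of \<open>K x\<close> that has the length of \<open>x\<close>, then apply the
  parallelogram law.\<close>

lemma symmetric_norm_le_numerical_bound:
  fixes K :: "'a::real_inner \<Rightarrow> 'a"
  assumes K: "linear K" and sym: "\<And>x y. inner (K x) y = inner x (K y)"
    and M: "subspace M" "\<And>x. x \<in> M \<Longrightarrow> K x \<in> M"
    and s: "\<And>x. x \<in> M \<Longrightarrow> \<bar>inner (K x) x\<bar> \<le> s * (norm x)\<^sup>2"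
    and x: "x \<in> M"
  shows "norm (K x) \<le> s * norm x"
proof (cases "K x = 0 \<or> x = 0")
  case True
  then show ?thesis
  proof
    assume "K x = 0"
    then have "0 \<le> s * (norm x)\<^sup>2" using s[OF x] by simp
    then have "0 \<le> s * norm x" by (cases "x = 0") (auto simp: zero_le_mult_iff)
    then show ?thesis using \<open>K x = 0\<close> by simp
  qed (simp add: linear_0[OF K])
next
  case False
  define y where "y = (norm x / norm (K x)) *\<^sub>R K x"
  have yM: "y \<in> M" using M x by (simp add: y_def subspace_scale)
  have ny: "norm y = norm x" using False by (simp add: y_def)
  have "4 * inner (K x) y = inner (K (x + y)) (x + y) - inner (K (x - y)) (x - y)"
    using sym[of y x] by (simp add: linear_add[OF K] linear_diff[OF K] inner_add_left inner_add_right
      inner_diff_left inner_diff_right inner_commute[of y])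
  also have "\<dots> \<le> s * (norm (x + y))\<^sup>2 + s * (norm (x - y))\<^sup>2"
    using s[of "x + y"] s[of "x - y"] x yM M(1) by (simp add: subspace_add subspace_diff)
  also have "\<dots> = 2 * s * ((norm x)\<^sup>2 + (norm y)\<^sup>2)"
    unfolding power2_norm_eq_inner
    by (simp add: inner_add_left inner_add_right inner_diff_left inner_diff_right algebra_simps)
  finally have "inner (K x) y \<le> s * (norm x)\<^sup>2" using ny by simp
  moreover have "inner (K x) y = norm x * norm (K x)"
    using False by (simp add: y_def dot_square_norm power2_eq_square)
  ultimately show ?thesis using False by (simp add: power2_eq_square)
qed

section \<open>Compact perturbations of a scalar\<close>

lemma symmetric_op_eigenvectors_orthogonal:
  fixes P :: "'a::real_inner \<Rightarrow> 'a"
  assumes "inner (P x) y = inner x (P y)" "P x = a *\<^sub>R x" "P y = b *\<^sub>R y" "a \<noteq> b"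
  shows "inner x y = 0"
  using assms by simp

text \<open>The condition \<open>small\<close> says that \<open>P - \<alpha>I\<close> is compact, in a form that avoids weak convergence.\<close>

locale scalar_plus_compact =
  fixes P :: "'a::{real_inner, banach} \<Rightarrow> 'a" and \<alpha> :: real
  assumes bounded_linear: "bounded_linear P"
    and sym: "inner (P x) y = inner x (P y)"
    and small: "\<epsilon> > 0 \<Longrightarrow> \<exists>F. finite F \<and>
      (\<forall>x. (\<forall>f\<in>F. inner x f = 0) \<longrightarrow> \<bar>inner (P x) x - \<alpha> * (norm x)\<^sup>2\<bar> \<le> \<epsilon> * (norm x)\<^sup>2)"
begin

sublocale P: bounded_linear P by (fact bounded_linear)

text \<open>A difference \<open>d\<close> of two vectors of the sequence is an approximate eigenvector almost orthogonal
  to the finite set, so its quadratic form is close both to \<open>\<sigma>\<parallel>d\<parallel>\<^sup>2\<close> and to \<open>\<alpha>\<parallel>d\<parallel>\<^sup>2\<close>.\<close>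

lemma approx_eigenvectors_convergent_subseq:
  fixes x :: "nat \<Rightarrow> 'a"
  assumes x: "\<And>n. norm (x n) = 1" and lim: "(\<lambda>n. P (x n) - \<sigma> *\<^sub>R x n) \<longlonglongrightarrow> 0"
    and "\<sigma> \<noteq> \<alpha>"
  shows "\<exists>r. strict_mono (r :: nat \<Rightarrow> nat) \<and> convergent (x \<circ> r)"
proof -
  \<comment> \<open>Half the gap: \<sigma> and \<alpha> times \<open>(norm d)\<^sup>2\<close> differ
    by \<open>2 * \<eta> * (norm d)\<^sup>2\<close>, and the form deviates from the latter by at
    most half of this plus error terms. So \<open>\<eta> * (norm d)\<^sup>2\<close> is bounded by
    error terms.\<close>
  define \<eta> where "\<eta> = \<bar>\<sigma> - \<alpha>\<bar> / 2"
  have \<eta>: "\<eta> > 0" using \<open>\<sigma> \<noteq> \<alpha>\<close> by (simp add: \<eta>_def)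
  obtain F where F: "finite F"
    "\<And>x. (\<forall>f\<in>F. inner x f = 0) \<Longrightarrow> \<bar>inner (P x) x - \<alpha> * (norm x)\<^sup>2\<bar> \<le> \<eta> * (norm x)\<^sup>2"
    using small[OF \<eta>] by blast
  obtain G where G: "finite G"
    "\<forall>g\<in>G. \<forall>h\<in>G. inner g h = (if g = h then 1 else 0)"
    "\<forall>x. (\<forall>g\<in>G. inner x g = 0) \<longrightarrow> (\<forall>f\<in>F. inner x f = 0)"
    using gram_schmidt_finite[OF F(1)] by (elim exE conjE) (rule that)
  obtain r where r: "strict_mono r" and conv: "\<And>g. g \<in> G \<Longrightarrow> convergent (\<lambda>n. inner (x (r n)) g)"
    using bounded_seq_finite_inner_convergent[OF G(1), of x 1] x by auto
  obtain L where L: "\<And>g. g \<in> G \<Longrightarrow> (\<lambda>n. inner (x (r n)) g) \<longlonglongrightarrow> L g"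
    using conv unfolding convergent_def by metis
  obtain B where B: "B \<ge> 0" "\<And>x. norm (P x) \<le> norm x * B"
    using P.nonneg_bounded by blast
  \<comment> \<open>Collects the coefficients of \<open>norm p\<close> in the three errors below:
    \<open>2 * B\<close> from each cross term and \<open>2 * \<bar>\<alpha>\<bar>\<close> from the
    square.\<close>
  define C where "C = 4 * B + 2 * \<bar>\<alpha>\<bar>"
  have C: "C \<ge> 0" using B by (simp add: C_def)
  define w where "w n = P (x (r n)) - \<sigma> *\<^sub>R x (r n)" for n
  define t where "t n = (C * (\<Sum>g\<in>G. \<bar>inner (x (r n)) g - L g\<bar>) + 2 * norm (w n)) / \<eta>" for n
  have "w \<longlonglongrightarrow> 0"
    using LIMSEQ_subseq_LIMSEQ[OF lim r] by (simp add: w_def[abs_def] o_def)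
  then have "t \<longlonglongrightarrow> (C * (\<Sum>g\<in>G. \<bar>L g - L g\<bar>) + 2 * norm (0 :: 'a)) / \<eta>"
    unfolding t_def using \<eta> by (intro tendsto_intros L) auto
  then have t0: "t \<longlonglongrightarrow> 0" by simp
  have "(norm (x (r m) - x (r n)))\<^sup>2 \<le> t m + t n" for m n
  proof -
    define d where "d = x (r m) - x (r n)"
    \<comment> \<open>The part of \<open>d\<close> in the span of \<open>G\<close>. Its coefficients
      are differences of terms of convergent sequences, hence small for large indices; the rest
      \<open>e\<close> is orthogonal to \<open>F\<close>, where the form is close to
      \<alpha>.\<close>
    define p where "p = (\<Sum>g\<in>G. inner d g *\<^sub>R g)"
    define e where "e = d - p"
    have de: "d = e + p" by (simp add: e_def)
    have eG: "inner e g = 0" if "g \<in> G" for g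
    proof -
      have "inner p g = (\<Sum>h\<in>G. if g = h then inner d h else 0)"
        unfolding p_def inner_sum_left using that G(2) by (intro sum.cong) auto
      then show ?thesis using that G(1) by (simp add: e_def inner_diff_left)
    qed
    have ep: "inner e p = 0" using eG by (simp add: p_def inner_sum_right)
    have "norm d \<le> 2" using norm_triangle_ineq4[of "x (r m)" "x (r n)"] x by (simp add: d_def)
    have nsq: "(norm d)\<^sup>2 = (norm e)\<^sup>2 + (norm p)\<^sup>2"
      unfolding de power2_norm_eq_inner using ep
      by (simp add: inner_add_left inner_add_right inner_commute)
    have "norm e \<le> norm d" by (rule power2_le_imp_le) (use nsq in auto)
    moreover have "norm p \<le> norm d" by (rule power2_le_imp_le) (use nsq in auto)
    ultimately have "norm e \<le> 2" "norm p \<le> 2" using \<open>norm d \<le> 2\<close> by auto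
    have "norm p \<le> (\<Sum>g\<in>G. \<bar>inner d g\<bar>)"
    proof -
      have "norm g = 1" if "g \<in> G" for g using G(2) that by (simp add: norm_eq_1)
      then have "norm (inner d g *\<^sub>R g) \<le> \<bar>inner d g\<bar>" if "g \<in> G" for g using that by simp
      then show ?thesis unfolding p_def by (intro sum_norm_le) auto
    qed
    also have "\<dots> \<le> (\<Sum>g\<in>G. \<bar>inner (x (r m)) g - L g\<bar> + \<bar>inner (x (r n)) g - L g\<bar>)"
      by (intro sum_mono) (simp add: d_def inner_diff_left)
    finally have "C * norm p \<le> C * (\<Sum>g\<in>G. \<bar>inner (x (r m)) g - L g\<bar> + \<bar>inner (x (r n)) g - L g\<bar>)"
      using C by (rule mult_left_mono)
    then have Cp: "C * norm p \<le> C * (\<Sum>g\<in>G. \<bar>inner (x (r m)) g - L g\<bar>) + C * (\<Sum>g\<in>G. \<bar>inner (x (r n)) g - L g\<bar>)"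
      by (simp add: sum.distrib distrib_left)
    have 1: "\<bar>inner (P d) p\<bar> \<le> 2 * B * norm p"
    proof -
      have "\<bar>inner (P d) p\<bar> \<le> norm (P d) * norm p" by (rule Cauchy_Schwarz_ineq2)
      also have "\<dots> \<le> (norm d * B) * norm p" by (intro mult_right_mono B) auto
      also have "\<dots> \<le> (2 * B) * norm p" by (intro mult_right_mono B \<open>norm d \<le> 2\<close>) auto
      finally show ?thesis .
    qed
    have 2: "\<bar>inner (P p) e\<bar> \<le> 2 * B * norm p"
    proof -
      have "\<bar>inner (P p) e\<bar> \<le> norm (P p) * norm e" by (rule Cauchy_Schwarz_ineq2)
      also have "\<dots> \<le> (norm p * B) * 2"
        using B \<open>norm e \<le> 2\<close> by (intro mult_mono) auto
      finally show ?thesis by (simp add: mult_ac)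
    qed
    have 3: "\<bar>\<alpha> * (norm p)\<^sup>2\<bar> \<le> 2 * \<bar>\<alpha>\<bar> * norm p"
    proof -
      have "(norm p)\<^sup>2 \<le> 2 * norm p"
        using \<open>norm p \<le> 2\<close> by (simp add: power2_eq_square mult_right_mono)
      then show ?thesis by (simp add: abs_mult mult.left_commute mult.assoc mult_left_mono)
    qed
    have Qdiff: "inner (P d) d - \<alpha> * (norm d)\<^sup>2
        = (inner (P e) e - \<alpha> * (norm e)\<^sup>2) + inner (P d) p + inner (P p) e - \<alpha> * (norm p)\<^sup>2"
      unfolding nsq unfolding de by (simp add: P.add inner_add_left inner_add_right algebra_simps)
    have Qe: "\<bar>inner (P e) e - \<alpha> * (norm e)\<^sup>2\<bar> \<le> \<eta> * (norm e)\<^sup>2"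
      using F(2)[of e] G(3) eG by blast
    have "\<eta> * (norm e)\<^sup>2 \<le> \<eta> * (norm d)\<^sup>2" using \<eta> nsq by simp
    then have Qd: "\<bar>inner (P d) d - \<alpha> * (norm d)\<^sup>2\<bar> \<le> \<eta> * (norm d)\<^sup>2 + C * norm p"
      using Qdiff Qe 1 2 3 unfolding C_def distrib_right by linarith
    have "inner (P d) d = \<sigma> * (norm d)\<^sup>2 + inner (w m - w n) d"
      unfolding power2_norm_eq_inner
      by (simp add: d_def w_def P.diff inner_diff_left algebra_simps)
    moreover have "\<bar>inner (w m - w n) d\<bar> \<le> 2 * norm (w m) + 2 * norm (w n)"
    proof -
      have "\<bar>inner (w m - w n) d\<bar> \<le> norm (w m - w n) * norm d" by (rule Cauchy_Schwarz_ineq2)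
      also have "\<dots> \<le> (norm (w m) + norm (w n)) * 2"
        using \<open>norm d \<le> 2\<close> by (intro mult_mono norm_triangle_ineq4) auto
      finally show ?thesis by simp
    qed
    moreover have "2 * \<eta> * (norm d)\<^sup>2 = \<bar>\<sigma> * (norm d)\<^sup>2 - \<alpha> * (norm d)\<^sup>2\<bar>"
      by (simp add: \<eta>_def left_diff_distrib[symmetric] abs_mult)
    ultimately have "\<eta> * (norm d)\<^sup>2 \<le> C * norm p + 2 * norm (w m) + 2 * norm (w n)"
      using Qd by linarith
    also have "\<dots> \<le> \<eta> * (t m + t n)"
      using Cp \<eta> by (simp add: t_def add_divide_distrib[symmetric])
    finally show ?thesis using \<eta> by (simp add: d_def)
  qed
  then have "Cauchy (\<lambda>n. x (r n))" using t0 by (rule Cauchy_if_norm_diff_sq_le[rotated])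
  then show ?thesis using r by (auto simp: Cauchy_convergent_iff o_def)
qed

text \<open>Rayleigh's principle for \<open>K\<close>, which is \<open>P\<close> minus \<alpha>. If
  its quadratic form vanishes on \<open>M\<close>, so does \<open>K\<close>, and all of
  \<open>M\<close> consists of eigenvectors for \<alpha>. Otherwise a maximising sequence for the
  absolute value of the form consists of approximate eigenvectors for a number other than \<alpha>,
  so a subsequence converges to an eigenvector.\<close>

lemma eigenvector_exists:
  assumes M: "subspace M" "closed M" "\<And>x. x \<in> M \<Longrightarrow> P x \<in> M" and "M \<noteq> {0}"
  shows "\<exists>\<mu>. \<exists>x\<in>M. x \<noteq> 0 \<and> P x = \<mu> *\<^sub>R x"
proof -
  define K where "K x = P x - \<alpha> *\<^sub>R x" for x
  have K: "linear K"
    unfolding K_def by (intro linear_compose_sub P.linear linear_scaleR)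
  have Ksym: "inner (K x) y = inner x (K y)" for x y
    by (simp add: K_def inner_diff_left inner_diff_right sym)
  have KM: "K x \<in> M" if "x \<in> M" for x
    using that M by (simp add: K_def subspace_diff subspace_scale)
  obtain B where B: "\<And>x. norm (K x) \<le> norm x * B"
    using bounded_linear.bounded[OF bounded_linear_sub[OF bounded_linear bounded_linear_scaleR_right[of \<alpha>]]]
    unfolding K_def by blast
  define S where "S = {x\<in>M. norm x = 1}"
  obtain z where z: "z \<in> M" "z \<noteq> 0" using M(1) \<open>M \<noteq> {0}\<close> subspace_0 by blast
  then have "sgn z \<in> S" using M(1) by (simp add: S_def sgn_div_norm subspace_scale)
  then have "S \<noteq> {}" by auto
  have "\<bar>inner (K x) x\<bar> \<le> B" if "x \<in> S" for x
    using Cauchy_Schwarz_ineq2[of "K x" x] B[of x] that by (simp add: S_def)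
  then have bdd: "bdd_above ((\<lambda>x. \<bar>inner (K x) x\<bar>) ` S)" by (rule bdd_aboveI2)
  define s where "s = (SUP x\<in>S. \<bar>inner (K x) x\<bar>)"
  have s_ge: "\<bar>inner (K x) x\<bar> \<le> s" if "x \<in> S" for x
    unfolding s_def using bdd that by (rule cSUP_upper[rotated])
  have s0: "s \<ge> 0" using s_ge[OF \<open>sgn z \<in> S\<close>] by linarith
  have "\<bar>inner (K x) x\<bar> \<le> s * (norm x)\<^sup>2" if "x \<in> M" for x
  proof (cases "x = 0")
    case False
    then have "sgn x \<in> S" using that M(1) by (simp add: S_def norm_sgn sgn_div_norm subspace_scale)
    moreover have "inner (K x) x = (norm x)\<^sup>2 * inner (K (sgn x)) (sgn x)"
      using False by (simp add: sgn_div_norm linear_scale[OF K] power2_eq_square field_simps)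
    ultimately show ?thesis
      using mult_left_mono[OF s_ge[of "sgn x"], of "(norm x)\<^sup>2"] by (simp add: abs_mult mult.commute)
  qed (simp add: linear_0[OF K])
  then have Kle: "norm (K x) \<le> s * norm x" if "x \<in> M" for x
    using symmetric_norm_le_numerical_bound[OF K Ksym M(1) KM _ that] by blast
  show ?thesis
  proof (cases "s = 0")
    case True
    then have "K z = 0" using Kle[OF z(1)] by simp
    then show ?thesis using z by (auto simp: K_def)
  next
    case False
    then have "s > 0" using s0 by simp
    have ex: "\<exists>x\<in>S. s - e < \<bar>inner (K x) x\<bar>" if "e > 0" for e
      using that less_cSUP_iff[OF \<open>S \<noteq> {}\<close> bdd, of "s - e"] by (auto simp: s_def)
    \<comment> \<open>The supremum of absolute values is approached with one fixed sign, and
      \<sigma> is \<open>s\<close> with that sign. If both signs failed, the smaller of the two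
      margins would contradict the choice of \<open>s\<close>.\<close>
    have "\<exists>\<sigma>. \<bar>\<sigma>\<bar> = s \<and> (\<forall>e>0. \<exists>x\<in>S. s * (s - e) \<le> \<sigma> * inner (K x) x)"
    proof (rule ccontr)
      assume no: "\<nexists>\<sigma>. \<bar>\<sigma>\<bar> = s \<and> (\<forall>e>0. \<exists>x\<in>S. s * (s - e) \<le> \<sigma> * inner (K x) x)"
      obtain e1 where e1: "e1 > 0" "\<And>x. x \<in> S \<Longrightarrow> s * inner (K x) x < s * (s - e1)"
        using no s0 by (metis abs_of_nonneg not_le)
      obtain e2 where e2: "e2 > 0" "\<And>x. x \<in> S \<Longrightarrow> - s * inner (K x) x < s * (s - e2)"
        using no s0 by (metis abs_of_nonneg abs_minus not_le)
      obtain x where x: "x \<in> S" "s - min e1 e2 < \<bar>inner (K x) x\<bar>" using ex[of "min e1 e2"] e1 e2 by auto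
      have "inner (K x) x < s - e1" using e1(2)[OF x(1)] \<open>s > 0\<close> by simp
      moreover have "s * (- inner (K x) x) < s * (s - e2)" using e2(2)[OF x(1)] by simp
      then have "- inner (K x) x < s - e2" using \<open>s > 0\<close> mult_less_cancel_left_pos by blast
      ultimately show False using x(2) by linarith
    qed
    then obtain \<sigma> where \<sigma>: "\<bar>\<sigma>\<bar> = s" "\<And>e. e > 0 \<Longrightarrow> \<exists>x\<in>S. s * (s - e) \<le> \<sigma> * inner (K x) x" by blast
    have "\<sigma>\<^sup>2 = s\<^sup>2" using \<sigma>(1) by (metis power2_abs)
    have "\<exists>x\<in>S. s * (s - inverse (real (Suc n))) \<le> \<sigma> * inner (K x) x" for n
      by (rule \<sigma>(2)) simp
    then obtain x where xS: "\<And>n. x n \<in> S"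
      and xs: "\<And>n. s * (s - inverse (real (Suc n))) \<le> \<sigma> * inner (K (x n)) (x n)" by metis
    have x1: "norm (x n) = 1" and xM: "x n \<in> M" for n using xS by (auto simp: S_def)
    \<comment> \<open>In the expanded square the outer terms are at most \<open>s\<^sup>2\<close>
      each, and the middle one nearly cancels them.\<close>
    have le: "(norm (K (x n) - \<sigma> *\<^sub>R x n))\<^sup>2 \<le> 2 * s * inverse (real (Suc n))" for n
    proof -
      have "(norm (K (x n) - \<sigma> *\<^sub>R x n))\<^sup>2
          = (norm (K (x n)))\<^sup>2 - 2 * (\<sigma> * inner (K (x n)) (x n)) + \<sigma>\<^sup>2 * (norm (x n))\<^sup>2"
        unfolding power2_norm_eq_inner
        by (simp add: inner_diff_left inner_diff_right inner_commute algebra_simps power2_eq_square)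
      also have "\<dots> \<le> s\<^sup>2 - 2 * (s * (s - inverse (real (Suc n)))) + s\<^sup>2"
        using xs[of n] power_mono[OF Kle[OF xM[of n]], of 2] x1 \<open>\<sigma>\<^sup>2 = s\<^sup>2\<close> by simp
      also have "\<dots> = 2 * s * inverse (real (Suc n))"
        by (simp add: algebra_simps power2_eq_square)
      finally show ?thesis .
    qed
    have "(\<lambda>n. 2 * s * inverse (real (Suc n))) \<longlonglongrightarrow> 0"
      by (intro tendsto_mult_right_zero LIMSEQ_inverse_real_of_nat)
    then have "(\<lambda>n. (norm (K (x n) - \<sigma> *\<^sub>R x n))\<^sup>2) \<longlonglongrightarrow> 0"
      by (rule Lim_null_comparison[rotated]) (use le in \<open>auto simp: always_eventually\<close>)
    then have "(\<lambda>n. norm (K (x n) - \<sigma> *\<^sub>R x n)) \<longlonglongrightarrow> 0"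
      using tendsto_real_sqrt by fastforce
    then have "(\<lambda>n. K (x n) - \<sigma> *\<^sub>R x n) \<longlonglongrightarrow> 0" by (rule tendsto_norm_zero_cancel)
    then have lim: "(\<lambda>n. P (x n) - (\<alpha> + \<sigma>) *\<^sub>R x n) \<longlonglongrightarrow> 0"
      by (simp add: K_def scaleR_add_left diff_diff_eq)
    moreover have "\<alpha> + \<sigma> \<noteq> \<alpha>" using \<sigma>(1) \<open>s > 0\<close> by auto
    ultimately obtain r y where r: "strict_mono r" and y: "(x \<circ> r) \<longlonglongrightarrow> y"
      using approx_eigenvectors_convergent_subseq[of x "\<alpha> + \<sigma>"] x1 by (auto simp: convergent_def)
    have "y \<in> M" using closed_sequentially[OF M(2) _ y] xM by simp
    have "(\<lambda>n. norm ((x \<circ> r) n)) \<longlonglongrightarrow> norm y" by (intro tendsto_intros y)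
    then have "norm y = 1" using x1 by (simp add: LIMSEQ_const_iff)
    have "(\<lambda>n. P ((x \<circ> r) n) - (\<alpha> + \<sigma>) *\<^sub>R (x \<circ> r) n) \<longlonglongrightarrow> P y - (\<alpha> + \<sigma>) *\<^sub>R y"
      by (intro tendsto_intros P.tendsto y)
    moreover have "(\<lambda>n. P ((x \<circ> r) n) - (\<alpha> + \<sigma>) *\<^sub>R (x \<circ> r) n) \<longlonglongrightarrow> 0"
      using LIMSEQ_subseq_LIMSEQ[OF lim r] by (simp add: o_def)
    ultimately have "P y = (\<alpha> + \<sigma>) *\<^sub>R y" using LIMSEQ_unique by fastforce
    then show ?thesis using \<open>y \<in> M\<close> \<open>norm y = 1\<close> by (intro exI bexI[of _ y]) auto
  qed
qed

text \<open>Eigenvalues can accumulate only at \<alpha>. Infinitely many at distance at least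
  \<epsilon> from \<alpha> would contain a sequence of distinct ones with a limit \<open>l\<close>
  other than \<alpha>; their unit eigenvectors would be approximate eigenvectors for
  \<open>l\<close> and have a convergent subsequence, although they are pairwise orthogonal.\<close>

lemma countable_eigenvalues: "countable {\<mu>. \<exists>x. x \<noteq> 0 \<and> P x = \<mu> *\<^sub>R x}" (is "countable ?E")
proof -
  obtain B where B: "\<And>x. norm (P x) \<le> norm x * B" using P.bounded by blast
  have EB: "\<bar>\<mu>\<bar> \<le> B" if "\<mu> \<in> ?E" for \<mu>
  proof -
    from that obtain x where "x \<noteq> 0" "P x = \<mu> *\<^sub>R x" by blast
    then show ?thesis using B[of x] by (simp add: mult.commute[of _ B])
  qed
  have fin: "finite {\<mu>\<in>?E. \<epsilon> \<le> \<bar>\<mu> - \<alpha>\<bar>}" (is "finite ?D") if "\<epsilon> > 0" for \<epsilon>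
  proof (rule ccontr)
    assume "infinite ?D"
    from infinite_countable_subset[OF this] obtain f :: "nat \<Rightarrow> real"
      where "inj f" and f: "range f \<subseteq> ?D" by (elim exE conjE) (rule that)
    have fE: "f n \<in> ?E" and f\<epsilon>: "\<epsilon> \<le> \<bar>f n - \<alpha>\<bar>" for n
      using subsetD[OF f rangeI[of f n]] by simp_all
    have "bounded (range f)" using EB[OF fE] by (intro boundedI[of _ B]) auto
    then obtain l q where q: "strict_mono (q :: nat \<Rightarrow> nat)" "(f \<circ> q) \<longlonglongrightarrow> l"
      using bounded_imp_convergent_subsequence by blast
    have "(\<lambda>n. \<bar>(f \<circ> q) n - \<alpha>\<bar>) \<longlonglongrightarrow> \<bar>l - \<alpha>\<bar>" by (intro tendsto_intros q)
    then have "\<epsilon> \<le> \<bar>l - \<alpha>\<bar>"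
      by (rule LIMSEQ_le_const) (use f\<epsilon> in simp)
    then have "l \<noteq> \<alpha>" using that by auto
    have "\<exists>x. norm x = 1 \<and> P x = f (q n) *\<^sub>R x" for n
    proof -
      obtain x where "x \<noteq> 0" "P x = f (q n) *\<^sub>R x" using fE[of "q n"] by auto
      then show ?thesis
        by (intro exI[of _ "sgn x"]) (simp add: norm_sgn sgn_div_norm P.scaleR)
    qed
    then obtain x where x1: "\<And>n. norm (x n) = 1" and xP: "\<And>n. P (x n) = f (q n) *\<^sub>R x n" by metis
    have "(\<lambda>n. \<bar>(f \<circ> q) n - l\<bar>) \<longlonglongrightarrow> \<bar>l - l\<bar>" by (intro tendsto_intros q)
    then have "(\<lambda>n. norm (P (x n) - l *\<^sub>R x n)) \<longlonglongrightarrow> 0"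
      by (simp add: xP x1 scaleR_diff_left[symmetric])
    then have lim: "(\<lambda>n. P (x n) - l *\<^sub>R x n) \<longlonglongrightarrow> 0" by (rule tendsto_norm_zero_cancel)
    obtain r where r: "strict_mono (r :: nat \<Rightarrow> nat)" "convergent (x \<circ> r)"
      using approx_eigenvectors_convergent_subseq[OF x1 lim \<open>l \<noteq> \<alpha>\<close>] by blast
    have dist: "(dist (x m) (x n))\<^sup>2 = 2" if "m \<noteq> n" for m n
    proof -
      have "f (q m) \<noteq> f (q n)"
        using that \<open>inj f\<close> strict_mono_eq[OF q(1)] by (simp add: inj_eq)
      then have "inner (x m) (x n) = 0"
        using symmetric_op_eigenvectors_orthogonal[of P "x m" "x n", OF sym xP xP] by blast
      then show ?thesis
        using x1 by (simp add: dist_norm power2_norm_eq_inner inner_diff_left inner_diff_right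
            inner_commute norm_eq_1)
    qed
    have "Cauchy (x \<circ> r)" using r(2) by (rule convergent_Cauchy)
    then obtain N where "\<forall>m\<ge>N. \<forall>n\<ge>N. dist ((x \<circ> r) m) ((x \<circ> r) n) < 1"
      by (meson metric_CauchyD zero_less_one)
    then have "dist (x (r N)) (x (r (Suc N))) < 1" by simp
    then have "(dist (x (r N)) (x (r (Suc N))))\<^sup>2 < 1"
      by (simp add: abs_square_less_1)
    moreover have "r N \<noteq> r (Suc N)" using strict_mono_eq[OF r(1)] by simp
    ultimately show False using dist by fastforce
  qed
  have "?E \<subseteq> {\<alpha>} \<union> (\<Union>n. {\<mu>\<in>?E. inverse (real (Suc n)) \<le> \<bar>\<mu> - \<alpha>\<bar>})"
  proof
    fix \<mu> assume "\<mu> \<in> ?E"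
    show "\<mu> \<in> {\<alpha>} \<union> (\<Union>n. {\<mu>\<in>?E. inverse (real (Suc n)) \<le> \<bar>\<mu> - \<alpha>\<bar>})"
    proof (cases "\<mu> = \<alpha>")
      case False
      then obtain n where "inverse (real (Suc n)) < \<bar>\<mu> - \<alpha>\<bar>"
        using reals_Archimedean[of "\<bar>\<mu> - \<alpha>\<bar>"] by auto
      then show ?thesis using \<open>\<mu> \<in> ?E\<close> by (auto intro: less_imp_le)
    qed simp
  qed
  moreover have "countable ({\<alpha>} \<union> (\<Union>n. {\<mu>\<in>?E. inverse (real (Suc n)) \<le> \<bar>\<mu> - \<alpha>\<bar>}))"
  proof -
    have "countable {\<mu>\<in>?E. inverse (real (Suc n)) \<le> \<bar>\<mu> - \<alpha>\<bar>}" for n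
      by (intro countable_finite fin) simp
    then show ?thesis by (intro countable_Un countable_UN) auto
  qed
  ultimately show ?thesis by (rule countable_subset)
qed

text \<open>The orthogonal complement of all eigenspaces is closed and invariant under the symmetric
  map \<open>P\<close>. If it were nonzero it would contain an eigenvector, which would be
  orthogonal to itself.\<close>

lemma eigenvector_expansion:
  obtains g :: "nat \<Rightarrow> real" where "inj g"
    "\<And>x. \<exists>y. (\<forall>n. P (y n) = g n *\<^sub>R y n) \<and> y sums x"
proof -
  let ?E = "{\<mu>. \<exists>x. x \<noteq> 0 \<and> P x = \<mu> *\<^sub>R x}"
  \<comment> \<open>The natural numbers are added only to make the set infinite, so that it can be
    enumerated injectively by \<open>nat\<close>. An added number that is no eigenvalue has the
    eigenspace {0}.\<close>
  define A where "A = ?E \<union> range real"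
  have "countable A" using countable_eigenvalues by (simp add: A_def)
  moreover have "infinite A"
    unfolding A_def using range_inj_infinite[OF inj_of_nat] by blast
  ultimately have bij: "bij_betw (from_nat_into A) UNIV A" by (rule bij_betw_from_nat_into)
  define g where "g = from_nat_into A"
  have g: "inj g" "range g = A" using bij by (auto simp: g_def bij_betw_def)
  define H where "H n = {x. P x = g n *\<^sub>R x}" for n
  have Hsub: "subspace (H n)" for n
    by (auto simp: H_def subspace_def P.add P.scaleR P.zero scaleR_add_right)
  have Hcl: "closed (H n)" for n
    unfolding H_def by (intro closed_Collect_eq continuous_intros P.continuous_on)
  have Horth: "inner x y = 0" if "x \<in> H m" "y \<in> H n" "m \<noteq> n" for x y m n
    using symmetric_op_eigenvectors_orthogonal[of P x y "g m" "g n", OF sym] that g(1)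
    by (simp add: H_def inj_eq)
  define M where "M = {x. \<forall>n. \<forall>y\<in>H n. inner x y = 0}"
  have "M = {0}"
  proof (rule ccontr)
    assume "M \<noteq> {0}"
    moreover have "subspace M" by (auto simp: M_def subspace_def inner_add_left)
    moreover have "closed M"
    proof -
      have "M = (\<Inter>n. \<Inter>y\<in>H n. {x. inner x y = 0})" by (auto simp: M_def)
      moreover have "closed {x. inner x y = 0}" for y :: 'a
        by (intro closed_Collect_eq continuous_intros)
      ultimately show ?thesis by auto
    qed
    moreover have "P x \<in> M" if "x \<in> M" for x
      using that by (auto simp: M_def H_def sym)
    ultimately obtain \<mu> x where x: "x \<in> M" "x \<noteq> 0" "P x = \<mu> *\<^sub>R x"
      using eigenvector_exists by blast
    then have "\<mu> \<in> range g" unfolding g(2) A_def by blast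
    then obtain n where "x \<in> H n" using x by (auto simp: H_def)
    then have "inner x x = 0" using x(1) unfolding M_def by blast
    then show False using x(2) by simp
  qed
  have "\<exists>y. (\<forall>n. P (y n) = g n *\<^sub>R y n) \<and> y sums x" for x
  proof -
    have "\<exists>p\<in>H n. \<forall>y\<in>H n. inner (x - p) y = 0" for n
      by (rule orthogonal_projection_exists) (fact Hsub Hcl)+
    then obtain y where yH: "\<And>n. y n \<in> H n" and yp: "\<And>n z. z \<in> H n \<Longrightarrow> inner (x - y n) z = 0"
      by metis
    have yorth: "inner (y m) (y n) = 0" if "m \<noteq> n" for m n using Horth yH that by blast
    \<comment> \<open>Bessel's inequality for the projections of \<open>x\<close> to the
      eigenspaces.\<close>
    have "(\<Sum>k<n. (norm (y k))\<^sup>2) \<le> (norm x)\<^sup>2" for n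
    proof -
      define p where "p = (\<Sum>k<n. y k)"
      have pn: "(\<Sum>k<n. (norm (y k))\<^sup>2) = (norm p)\<^sup>2" unfolding p_def
        by (rule norm_sum_Pythagorean[symmetric]) (auto simp: pairwise_def orthogonal_def yorth)
      have "inner x (y k) = (norm (y k))\<^sup>2" for k
        using yp[OF yH, of k] by (simp add: inner_diff_left power2_norm_eq_inner)
      then have "inner x p = (norm p)\<^sup>2"
        unfolding pn[symmetric] by (simp add: p_def inner_sum_right)
      moreover have "0 \<le> (norm (x - p))\<^sup>2" by simp
      ultimately have "(norm p)\<^sup>2 \<le> (norm x)\<^sup>2"
        unfolding power2_norm_eq_inner by (simp add: inner_diff_left inner_diff_right inner_commute)
      then show ?thesis using pn by simp
    qed
    then have "summable (\<lambda>k. (norm (y k))\<^sup>2)"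
      by (intro summableI_nonneg_bounded) auto
    then obtain z where z: "y sums z"
      using summable_orthogonal[of y] yorth by (auto simp: summable_def)
    have "inner (x - z) w = 0" if "w \<in> H n" for n w
    proof -
      have "inner z w = inner (y n) w"
        using Horth yH that by (intro inner_orthogonal_series[OF _ z]) blast
      then show ?thesis using yp[OF that] by (simp add: inner_diff_left)
    qed
    then have "x - z \<in> M" by (auto simp: M_def)
    then show ?thesis using z yH \<open>M = {0}\<close> by (auto simp: H_def)
  qed
  then show thesis using that g(1) by blast
qed

end

section \<open>Complex inner product spaces and adjoints\<close>

lemma cinner_self: "cinner x x = complex_of_real ((norm x)\<^sup>2)"
  using cinner_commute[of x x]
  by (simp add: complex_eq_iff power2_norm_eq_inner inner_eq_Re_cinner)

lemma cinner_zero_left: "cinner 0 x = 0"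
  using cinner_scaleC_left[of 0 0 x] by simp

lemma cinner_scaleC_right: "cinner x (c *\<^sub>C y) = cnj c * cinner x y"
  using cinner_commute[of x] cinner_scaleC_left[of c y x] by simp

text \<open>The imaginary part of the complex product is a real product with
  \<open>\<i> *\<^sub>C y\<close>, so complex orthogonality to \<open>y\<close> is a pair of real
  orthogonality conditions. This links the real theory above with the complex statements.\<close>

lemma cinner_eq_Complex_inner: "cinner x y = Complex (inner x y) (inner x (\<i> *\<^sub>C y))"
  by (simp add: complex_eq_iff inner_eq_Re_cinner cinner_scaleC_right)

lemma cinner_eq_0_iff: "cinner x y = 0 \<longleftrightarrow> inner x y = 0 \<and> inner x (\<i> *\<^sub>C y) = 0"
  by (simp add: cinner_eq_Complex_inner complex_eq_iff)

lemma inner_scaleC_left: "inner (c *\<^sub>C x) y = inner x (cnj c *\<^sub>C y)"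
  by (simp add: inner_eq_Re_cinner cinner_scaleC_left cinner_scaleC_right)

lemma norm_scaleC: "norm (c *\<^sub>C x) = cmod c * norm x"
proof -
  have "complex_of_real ((norm (c *\<^sub>C x))\<^sup>2) = c * cnj c * complex_of_real ((norm x)\<^sup>2)"
    unfolding cinner_self[symmetric] by (simp add: cinner_scaleC_left cinner_scaleC_right)
  also have "\<dots> = complex_of_real ((cmod c * norm x)\<^sup>2)"
    by (simp only: complex_norm_square[symmetric] power_mult_distrib of_real_mult)
  finally show ?thesis
    by (metis of_real_eq_iff norm_ge_zero power2_eq_iff_nonneg mult_nonneg_nonneg)
qed

lemma scaleC_scaleR_commute: "c *\<^sub>C r *\<^sub>R x = r *\<^sub>R c *\<^sub>C x"
  by (simp add: scaleR_scaleC scaleC_scaleC mult.commute)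

lemma bounded_linear_scaleC: "bounded_linear (\<lambda>x. c *\<^sub>C x)"
  by (rule bounded_linear_intro[of _ "cmod c"])
    (simp_all add: scaleC_add_right scaleC_scaleR_commute norm_scaleC mult.commute)

lemma csubspace_imp_subspace: "complex_vector.subspace M \<Longrightarrow> subspace M"
  by (auto simp: complex_vector.subspace_def subspace_def scaleR_scaleC)

lemma csubspace_closure:
  assumes M: "complex_vector.subspace M"
  shows "complex_vector.subspace (closure M)"
  unfolding complex_vector.subspace_def
proof (intro conjI ballI allI)
  show "0 \<in> closure M"
    using complex_vector.subspace_0[OF M] closure_subset by blast
next
  fix x y assume "x \<in> closure M" "y \<in> closure M"
  then obtain f g where "\<And>n. f n \<in> M" "f \<longlonglongrightarrow> x" "\<And>n. g n \<in> M" "g \<longlonglongrightarrow> y"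
    unfolding closure_sequential by blast
  then show "x + y \<in> closure M"
    unfolding closure_sequential
    by (intro exI[of _ "\<lambda>n. f n + g n"])
      (auto intro: tendsto_add complex_vector.subspace_add[OF M])
next
  fix c x assume "x \<in> closure M"
  then obtain f where "\<And>n. f n \<in> M" "f \<longlonglongrightarrow> x"
    unfolding closure_sequential by blast
  then show "c *\<^sub>C x \<in> closure M"
    unfolding closure_sequential
    by (intro exI[of _ "\<lambda>n. c *\<^sub>C f n"])
      (auto intro: bounded_linear.tendsto[OF bounded_linear_scaleC]
        complex_vector.subspace_scale[OF M])
qed

section \<open>Complex-linear operators and their adjoints\<close>

lemma bounded_ops_scaleC: "T \<in> bounded_ops \<Longrightarrow> T (c *\<^sub>C x) = c *\<^sub>C T x"
  by (simp add: bounded_ops_def)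

lemma closed_bounded_ops: "closed bounded_ops"
proof -
  have eq: "bounded_ops = (\<Inter>c. \<Inter>x. {T :: 'a \<Rightarrow>\<^sub>L 'a. T (c *\<^sub>C x) = c *\<^sub>C T x})"
    by (auto simp: bounded_ops_def)
  have "closed {T :: 'a \<Rightarrow>\<^sub>L 'a. T (c *\<^sub>C x) = c *\<^sub>C T x}" for c x
    by (intro closed_Collect_eq bounded_linear.continuous_on[OF bounded_linear_scaleC] continuous_intros)
  then show ?thesis unfolding eq by (intro closed_INT ballI)
qed

lemma bounded_ops_eqI_inner:
  fixes S R :: "'a::complex_inner \<Rightarrow>\<^sub>L 'a"
  assumes "\<And>x y. inner x (S y) = inner x (R y)"
  shows "S = R"
  using assms vector_eq_ldot by (intro blinfun_eqI) blast

text \<open>Riesz representation on the whole space gives the adjoint for the real inner product. It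
  is complex linear because \<open>T\<close> is and because a scalar moves across the real product
  as its conjugate.\<close>

lemma cadjoint_exists:
  fixes T :: "'a::complex_hilbert \<Rightarrow>\<^sub>L 'a"
  assumes T: "T \<in> bounded_ops"
  shows "\<exists>S\<in>bounded_ops. \<forall>x y. cinner (T x) y = cinner x (S y)"
proof -
  have "\<exists>m. \<forall>x. inner (T x) y = inner x m" for y
  proof -
    have "bounded_linear (\<lambda>x. inner (T x) y)"
      by (intro bounded_linear_inner_left_comp blinfun.bounded_linear_right)
    then obtain m where "\<And>x. x \<in> UNIV \<Longrightarrow> inner (T x) y = inner m x"
      using riesz_closed_subspace[OF subspace_UNIV closed_UNIV] by blast
    then show ?thesis by (auto simp: inner_commute)
  qed
  then obtain S where S: "\<And>x y. inner (T x) y = inner x (S y)" by metis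
  have eqI: "u = v" if "\<And>x. inner x u = inner x v" for u v :: 'a
    using that vector_eq_ldot by blast
  have SC: "S (c *\<^sub>C y) = c *\<^sub>C S y" for c y
  proof (rule eqI)
    fix x
    have "inner x (S (c *\<^sub>C y)) = inner (cnj c *\<^sub>C T x) y"
      by (simp add: S[symmetric] inner_scaleC_left)
    also have "\<dots> = inner (T (cnj c *\<^sub>C x)) y"
      by (simp add: bounded_ops_scaleC[OF T])
    also have "\<dots> = inner x (c *\<^sub>C S y)"
      unfolding S by (simp add: inner_scaleC_left)
    finally show "inner x (S (c *\<^sub>C y)) = inner x (c *\<^sub>C S y)" .
  qed
  have "bounded_linear S"
  proof (rule bounded_linear_intro[of _ "norm T"])
    show "S (x + y) = S x + S y" for x y
      by (rule eqI) (simp add: S[symmetric] inner_add_right)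
    show "S (r *\<^sub>R x) = r *\<^sub>R S x" for r x
      by (simp add: scaleR_scaleC SC)
    show "norm (S y) \<le> norm y * norm T" for y
    proof (cases "S y = 0")
      case False
      have "norm (S y) * norm (S y) = inner (T (S y)) y"
        by (simp add: S dot_square_norm power2_eq_square)
      also have "\<dots> \<le> norm (T (S y)) * norm y" by (rule norm_cauchy_schwarz)
      also have "\<dots> \<le> norm T * norm (S y) * norm y" by (intro mult_right_mono norm_blinfun) auto
      also have "\<dots> = norm (S y) * (norm y * norm T)" by simp
      finally show ?thesis using False by simp
    qed simp
  qed
  then have app: "blinfun_apply (Blinfun S) = S" by (rule bounded_linear_Blinfun_apply)
  show ?thesis
  proof (intro bexI allI)
    show "Blinfun S \<in> bounded_ops" by (simp add: bounded_ops_def app SC)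
    show "cinner (T x) y = cinner x (Blinfun S y)" for x y
      by (simp add: app cinner_eq_Complex_inner S SC)
  qed
qed

lemma cadjoint:
  fixes T :: "'a::complex_hilbert \<Rightarrow>\<^sub>L 'a"
  assumes T: "T \<in> bounded_ops"
  shows cadjoint_bounded_ops: "cadjoint T \<in> bounded_ops"
    and cinner_cadjoint: "cinner (T x) y = cinner x (cadjoint T y)"
proof -
  have "\<exists>!S. S \<in> bounded_ops \<and> (\<forall>x y. cinner (T x) y = cinner x (S y))"
  proof (rule ex_ex1I)
    show "\<exists>S. S \<in> bounded_ops \<and> (\<forall>x y. cinner (T x) y = cinner x (S y))"
      using cadjoint_exists[OF T] by blast
    show "S = R" if "S \<in> bounded_ops \<and> (\<forall>x y. cinner (T x) y = cinner x (S y))"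
      "R \<in> bounded_ops \<and> (\<forall>x y. cinner (T x) y = cinner x (R y))" for S R
      using that by (intro bounded_ops_eqI_inner) (simp add: inner_eq_Re_cinner)
  qed
  then have "cadjoint T \<in> bounded_ops \<and> (\<forall>x y. cinner (T x) y = cinner x (cadjoint T y))"
    unfolding cadjoint_def by (rule theI')
  then show "cadjoint T \<in> bounded_ops" "cinner (T x) y = cinner x (cadjoint T y)"
    by blast+
qed

lemma inner_cadjoint:
  fixes T :: "'a::complex_hilbert \<Rightarrow>\<^sub>L 'a"
  assumes "T \<in> bounded_ops"
  shows "inner (T x) y = inner x (cadjoint T y)"
  using cinner_cadjoint[OF assms] by (simp add: inner_eq_Re_cinner)

section \<open>Limits of absolutely norm attaining operators\<close>

lemma closure_AN_ops_subset_bounded_ops: "closure AN_ops \<subseteq> bounded_ops"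
  by (intro closure_minimal closed_bounded_ops) (auto simp: AN_ops_def)

text \<open>An intermediate value argument made explicit. With \<open>u\<close> and \<open>v\<close>
  orthogonal and their images orthogonal too,
  \<open>sqrt (1 - t) *\<^sub>R u + sqrt t *\<^sub>R v\<close> is a unit vector whose image has
  squared norm linear in \<open>t\<close>.\<close>

lemma unit_vector_with_prescribed_norm:
  fixes A :: "'a::complex_hilbert \<Rightarrow>\<^sub>L 'a"
  assumes A: "A \<in> bounded_ops"
    and lo: "\<And>F. finite F \<Longrightarrow> \<exists>x. norm x = 1 \<and> (\<forall>f\<in>F. inner x f = 0) \<and> norm (A x) \<le> c"
    and hi: "\<And>F. finite F \<Longrightarrow> \<exists>x. norm x = 1 \<and> (\<forall>f\<in>F. inner x f = 0) \<and> c \<le> norm (A x)"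
    and F: "finite F"
  shows "\<exists>x. norm x = 1 \<and> (\<forall>f\<in>F. inner x f = 0) \<and> norm (A x) = c"
proof -
  obtain u where u: "norm u = 1" "\<forall>f\<in>F. inner u f = 0" "norm (A u) \<le> c"
    using lo[OF F] by blast
  \<comment> \<open>Orthogonality to \<open>cadjoint A (A u)\<close> is what makes
    \<open>A v\<close> orthogonal to \<open>A u\<close>.\<close>
  obtain v where v: "norm v = 1" "\<forall>f\<in>insert u (insert (cadjoint A (A u)) F). inner v f = 0"
    "c \<le> norm (A v)"
    using hi[of "insert u (insert (cadjoint A (A u)) F)"] F by auto
  define p q where "p = (norm (A u))\<^sup>2" and "q = (norm (A v))\<^sup>2"
  have "0 \<le> c" using u(3) norm_ge_zero order_trans by blast
  then have pq: "p \<le> c\<^sup>2" "c\<^sup>2 \<le> q" using u(3) v(3) by (simp_all add: p_def q_def power_mono)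
  obtain t where t: "0 \<le> t" "t \<le> 1" "(1 - t) * p + t * q = c\<^sup>2"
  proof (cases "p = q")
    case True
    then show ?thesis using pq that[of 0] by simp
  next
    case False
    then have "q - p > 0" using pq by simp
    define t where "t = (c\<^sup>2 - p) / (q - p)"
    have "t * (q - p) = c\<^sup>2 - p" using \<open>q - p > 0\<close> by (simp add: t_def)
    then have "(1 - t) * p + t * q = c\<^sup>2" by (simp add: algebra_simps)
    moreover have "0 \<le> t" "t \<le> 1" using pq \<open>q - p > 0\<close> by (simp_all add: t_def)
    ultimately show ?thesis using that by blast
  qed
  define x where "x = sqrt (1 - t) *\<^sub>R u + sqrt t *\<^sub>R v"
  have uv: "inner u v = 0" using v(2) by (simp add: inner_commute)
  have Auv: "inner (A u) (A v) = 0"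
    using v(2) inner_cadjoint[OF A, of v "A u"] by (simp add: inner_commute)
  have "(norm x)\<^sup>2 = (sqrt (1 - t))\<^sup>2 * (norm u)\<^sup>2 + (sqrt t)\<^sup>2 * (norm v)\<^sup>2"
    unfolding x_def by (subst norm_add_Pythagorean) (simp_all add: orthogonal_def uv power_mult_distrib)
  then have "(norm x)\<^sup>2 = 1" using t u(1) v(1) by simp
  then have "norm x = 1" using abs_square_eq_1[of "norm x"] by simp
  moreover have "(norm (A x))\<^sup>2 = (sqrt (1 - t))\<^sup>2 * p + (sqrt t)\<^sup>2 * q"
    unfolding x_def p_def q_def blinfun.add_right blinfun.scaleR_right
    by (subst norm_add_Pythagorean) (simp_all add: orthogonal_def Auv power_mult_distrib)
  then have "(norm (A x))\<^sup>2 = c\<^sup>2" using t by simp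
  then have "norm (A x) = c" using \<open>0 \<le> c\<close> by simp
  moreover have "\<forall>f\<in>F. inner x f = 0" using u(2) v(2) by (simp add: x_def inner_add_left)
  ultimately show ?thesis by blast
qed

text \<open>For \<open>z\<close> in the kernel of the positive semidefinite form \<open>b\<^sup>2\<parallel>z\<parallel>\<^sup>2 - \<parallel>A z\<parallel>\<^sup>2\<close> the linear term of the
  form along \<open>z + t y\<close> vanishes.\<close>

lemma norm_attained_imp_inner_eq:
  fixes A :: "'a::real_inner \<Rightarrow>\<^sub>L 'a"
  assumes N: "subspace N" and le: "\<And>y. y \<in> N \<Longrightarrow> norm (A y) \<le> b * norm y"
    and z: "z \<in> N" "norm (A z) = b * norm z" and y: "y \<in> N"
  shows "inner (A z) (A y) = b\<^sup>2 * inner z y"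
proof -
  define u where "u = inner (A z) (A y) - b\<^sup>2 * inner z y"
  define v where "v = (norm (A y))\<^sup>2 - b\<^sup>2 * (norm y)\<^sup>2"
  have *: "2 * t * u + t\<^sup>2 * v \<le> 0" for t
  proof -
    have "(norm (A (z + t *\<^sub>R y)))\<^sup>2 \<le> (b * norm (z + t *\<^sub>R y))\<^sup>2"
      using N z y by (intro power_mono le) (auto simp: subspace_add subspace_scale)
    moreover have "(norm (A z))\<^sup>2 = b\<^sup>2 * (norm z)\<^sup>2" using z(2) by (simp add: power_mult_distrib)
    moreover have "(norm (A (z + t *\<^sub>R y)))\<^sup>2 = (norm (A z))\<^sup>2 + 2 * t * inner (A z) (A y) + t\<^sup>2 * (norm (A y))\<^sup>2"
      unfolding power2_norm_eq_inner
      by (simp add: blinfun.add_right blinfun.scaleR_right inner_add_left inner_add_right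
          inner_commute power2_eq_square)
    moreover have "(norm (z + t *\<^sub>R y))\<^sup>2 = (norm z)\<^sup>2 + 2 * t * inner z y + t\<^sup>2 * (norm y)\<^sup>2"
      unfolding power2_norm_eq_inner
      by (simp add: inner_add_left inner_add_right inner_commute power2_eq_square)
    ultimately show ?thesis by (simp add: u_def v_def power_mult_distrib algebra_simps)
  qed
  \<comment> \<open>Chosen so that \<open>2 * w + v\<close> is positive: at \<open>t = u / w\<close>
    the left side of \<open>*\<close> becomes \<open>(u / w)\<^sup>2 * (2 * w + v)\<close>, which
    forces \<open>u = 0\<close>.\<close>
  define w where "w = 1 + \<bar>v\<bar>"
  have w: "w > 0" "2 * w + v > 0" by (auto simp: w_def)
  have "2 * (u / w) * u + (u / w)\<^sup>2 * v = (u / w)\<^sup>2 * (2 * w + v)"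
    using w(1) by (simp add: field_simps power2_eq_square)
  then have "(u / w)\<^sup>2 * (2 * w + v) \<le> 0" using *[of "u / w"] by simp
  then have "u = 0" using w by (simp add: mult_le_0_iff)
  then show ?thesis by (simp add: u_def)
qed

text \<open>Otherwise there is an orthonormal sequence \<open>x\<close> with orthogonal images such that \<open>\<parallel>A (x n)\<parallel>\<close>
  increases strictly to \<open>b\<close>, and \<open>A\<close> does not attain its norm on the closed span of \<open>x\<close>.\<close>

lemma AN_ops_norm_gap:
  fixes A :: "'a::complex_hilbert \<Rightarrow>\<^sub>L 'a"
  assumes AN: "A \<in> AN_ops" and "0 \<le> a" "a < b"
  shows "\<exists>F. finite F \<and> ((\<forall>x. norm x = 1 \<and> (\<forall>f\<in>F. inner x f = 0) \<longrightarrow> a < norm (A x)) \<or>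
    (\<forall>x. norm x = 1 \<and> (\<forall>f\<in>F. inner x f = 0) \<longrightarrow> norm (A x) < b))"
proof (rule ccontr)
  assume no: "\<not> ?thesis"
  have A: "A \<in> bounded_ops" using AN by (simp add: AN_ops_def)
  have lo: "\<exists>x. norm x = 1 \<and> (\<forall>f\<in>F. inner x f = 0) \<and> norm (A x) \<le> a" if "finite F" for F
    using no that by (meson not_le)
  have hi: "\<exists>x. norm x = 1 \<and> (\<forall>f\<in>F. inner x f = 0) \<and> b \<le> norm (A x)" if "finite F" for F
    using no that by (meson not_le)
  define B where "B = cadjoint A o\<^sub>L A"
  \<comment> \<open>Starts at \<open>a\<close> for \<open>n = 0\<close> and tends to
    \<open>b\<close> without reaching it.\<close>
  define \<gamma> where "\<gamma> n = b - (b - a) * inverse (real (Suc n))" for n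
  have \<gamma>: "a \<le> \<gamma> n" "\<gamma> n < b" for n
  proof -
    have "inverse (real (Suc n)) \<le> 1" by (simp add: field_simps)
    then have "(b - a) * inverse (real (Suc n)) \<le> (b - a) * 1"
      using \<open>a < b\<close> by (intro mult_left_mono) auto
    then show "a \<le> \<gamma> n" by (simp add: \<gamma>_def)
    show "\<gamma> n < b" using \<open>a < b\<close> by (simp add: \<gamma>_def)
  qed
  have "(\<lambda>n. b - (b - a) * inverse (real (Suc n))) \<longlonglongrightarrow> b - (b - a) * 0"
    by (intro tendsto_intros LIMSEQ_inverse_real_of_nat)
  then have \<gamma>_lim: "\<gamma> \<longlonglongrightarrow> b" by (simp add: \<gamma>_def[abs_def])
  have step: "\<exists>x. norm x = 1 \<and> (\<forall>f\<in>F. inner x f = 0) \<and> norm (A x) = \<gamma> n" if "finite F" for F n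
  proof (rule unit_vector_with_prescribed_norm[OF A _ _ that])
    show "\<exists>x. norm x = 1 \<and> (\<forall>f\<in>F. inner x f = 0) \<and> norm (A x) \<le> \<gamma> n" if "finite F" for F
      using lo[OF that] \<gamma>(1)[of n] order_trans by blast
    show "\<exists>x. norm x = 1 \<and> (\<forall>f\<in>F. inner x f = 0) \<and> \<gamma> n \<le> norm (A x)" if "finite F" for F
      using hi[OF that] \<gamma>(2)[of n] by (meson less_imp_le order_trans)
  qed
  \<comment> \<open>What \<open>x n\<close> must be orthogonal to: the earlier vectors, and their
    images under \<open>B\<close> so that the vectors \<open>A (x m)\<close> are orthogonal as well.
    The multiples by \<i> turn real orthogonality into complex orthogonality.\<close>
  define G where "G x n = (\<Union>m<n. {x m, \<i> *\<^sub>C x m, B (x m), \<i> *\<^sub>C B (x m)})" for x :: "nat \<Rightarrow> 'a" and n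
  have "\<exists>x. \<forall>n. norm (x n) = 1 \<and> (\<forall>f\<in>G x n. inner (x n) f = 0) \<and> norm (A (x n)) = \<gamma> n"
  proof (rule dependent_wf_choice[OF wf_less])
    fix f g :: "nat \<Rightarrow> 'a" and n r
    assume "\<And>m. (m, n) \<in> {(x, y). x < y} \<Longrightarrow> f m = g m"
    then have "G f n = G g n" by (simp add: G_def)
    then show "(norm r = 1 \<and> (\<forall>h\<in>G f n. inner r h = 0) \<and> norm (A r) = \<gamma> n) =
      (norm r = 1 \<and> (\<forall>h\<in>G g n. inner r h = 0) \<and> norm (A r) = \<gamma> n)" by simp
  next
    fix n and f :: "nat \<Rightarrow> 'a"
    show "\<exists>r. norm r = 1 \<and> (\<forall>h\<in>G f n. inner r h = 0) \<and> norm (A r) = \<gamma> n"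
      by (rule step) (simp add: G_def)
  qed
  then obtain x where x1: "\<And>n. norm (x n) = 1" and xG: "\<And>n f. f \<in> G x n \<Longrightarrow> inner (x n) f = 0"
    and xA: "\<And>n. norm (A (x n)) = \<gamma> n" by blast
  have lt: "cinner (x n) (x m) = 0 \<and> cinner (A (x n)) (A (x m)) = 0" if "m < n" for m n
  proof -
    have "cinner (x n) (x m) = 0" "cinner (x n) (B (x m)) = 0"
      unfolding cinner_eq_0_iff using that by (auto intro!: xG simp: G_def)
    then show ?thesis by (simp add: cinner_cadjoint[OF A] B_def)
  qed
  have orth: "cinner (x n) (x m) = 0" "cinner (A (x n)) (A (x m)) = 0" if "m \<noteq> n" for m n
    using that lt[of m n] lt[of n m] cinner_commute[of "x n" "x m"]
      cinner_commute[of "A (x n)" "A (x m)"] by (cases m n rule: linorder_cases; simp)+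
  define S where "S = complex_vector.span (range x)"
  define N where "N = closure S"
  have S: "complex_vector.subspace S" by (simp add: S_def)
  then have N: "complex_vector.subspace N" unfolding N_def by (rule csubspace_closure)
  have Nsub: "subspace N" by (rule csubspace_imp_subspace[OF N])
  have xS: "x n \<in> S" for n unfolding S_def by (rule complex_vector.span_base) simp
  have xN: "x n \<in> N" for n using xS closure_subset unfolding N_def by blast
  have bS: "norm (A z) \<le> b * norm z" if zS: "z \<in> S" for z
  proof -
    obtain t r where t: "finite t" "t \<subseteq> range x" and z: "z = (\<Sum>v\<in>t. r v *\<^sub>C v)"
      using zS unfolding S_def complex_vector.span_explicit by blast
    have "inner (r v *\<^sub>C v) (r w *\<^sub>C w) = 0" "inner (r v *\<^sub>C A v) (r w *\<^sub>C A w) = 0"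
      if "v \<in> t" "w \<in> t" "v \<noteq> w" for v w
    proof -
      from t(2) that obtain m n where "v = x m" "w = x n" by blast
      then have "cinner v w = 0" "cinner (A v) (A w) = 0" using orth[of n m] \<open>v \<noteq> w\<close> by auto
      then show "inner (r v *\<^sub>C v) (r w *\<^sub>C w) = 0" "inner (r v *\<^sub>C A v) (r w *\<^sub>C A w) = 0"
        by (simp_all add: inner_eq_Re_cinner cinner_scaleC_left cinner_scaleC_right)
    qed
    then have o1: "pairwise (\<lambda>v w. orthogonal (r v *\<^sub>C v) (r w *\<^sub>C w)) t"
      and o2: "pairwise (\<lambda>v w. orthogonal (r v *\<^sub>C A v) (r w *\<^sub>C A w)) t"
      by (auto simp: pairwise_def orthogonal_def)
    have "A z = (\<Sum>v\<in>t. r v *\<^sub>C A v)"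
      unfolding z blinfun.sum_right by (simp add: bounded_ops_scaleC[OF A])
    then have "(norm (A z))\<^sup>2 = (\<Sum>v\<in>t. (norm (r v *\<^sub>C A v))\<^sup>2)"
      using norm_sum_Pythagorean[OF t(1) o2] by simp
    also have "\<dots> \<le> (\<Sum>v\<in>t. b\<^sup>2 * (norm (r v *\<^sub>C v))\<^sup>2)"
    proof (intro sum_mono)
      fix v assume "v \<in> t"
      then obtain n where n: "v = x n" using t(2) by blast
      have "(\<gamma> n)\<^sup>2 \<le> b\<^sup>2" using \<gamma>[of n] \<open>0 \<le> a\<close> by (intro power_mono) auto
      then show "(norm (r v *\<^sub>C A v))\<^sup>2 \<le> b\<^sup>2 * (norm (r v *\<^sub>C v))\<^sup>2"
        using mult_left_mono[of "(\<gamma> n)\<^sup>2" "b\<^sup>2" "(cmod (r v))\<^sup>2"]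
        by (simp add: n norm_scaleC xA x1 power_mult_distrib mult.commute)
    qed
    also have "\<dots> = (b * norm z)\<^sup>2"
      using norm_sum_Pythagorean[OF t(1) o1] by (simp add: z power_mult_distrib sum_distrib_left)
    finally show ?thesis
      using \<open>0 \<le> a\<close> \<open>a < b\<close> by (intro power2_le_imp_le[of "norm (A z)" "b * norm z"]) auto
  qed
  have bN: "norm (A z) \<le> b * norm z" if "z \<in> N" for z
  proof -
    have "closed {z. norm (A z) \<le> b * norm z}" by (intro closed_Collect_le continuous_intros)
    then have "N \<subseteq> {z. norm (A z) \<le> b * norm z}"
      unfolding N_def using bS by (intro closure_minimal) auto
    then show ?thesis using that by blast
  qed
  \<comment> \<open>On the closed span each \<open>x n\<close> behaves like an eigenvector of the
    compression of \<open>B\<close>, with eigenvalue \<open>(\<gamma> n)\<^sup>2\<close>. The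
    identity is checked on generators, then extended to the span and its closure.\<close>
  have eqS: "cinner (A z) (A (x n)) = complex_of_real ((\<gamma> n)\<^sup>2) * cinner z (x n)" if "z \<in> S" for z n
    using that unfolding S_def
  proof (rule complex_vector.span_induct)
    show "complex_vector.subspace {z. cinner (A z) (A (x n)) = complex_of_real ((\<gamma> n)\<^sup>2) * cinner z (x n)}"
      by (auto simp: complex_vector.subspace_def blinfun.add_right bounded_ops_scaleC[OF A]
          cinner_zero_left cinner_add_left cinner_scaleC_left algebra_simps)
    fix z assume "z \<in> range x"
    then obtain m where "z = x m" by blast
    then show "cinner (A z) (A (x n)) = complex_of_real ((\<gamma> n)\<^sup>2) * cinner z (x n)"
      using orth[of n m] by (cases "m = n") (simp_all add: cinner_self x1 xA)
  qed
  have eqN: "inner (A z) (A (c *\<^sub>C x n)) = (\<gamma> n)\<^sup>2 * inner z (c *\<^sub>C x n)" if "z \<in> N" for z n c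
  proof -
    have "inner (A z) (A (c *\<^sub>C x n)) = (\<gamma> n)\<^sup>2 * inner z (c *\<^sub>C x n)" if "z \<in> S" for z
      unfolding bounded_ops_scaleC[OF A] inner_eq_Re_cinner cinner_scaleC_right eqS[OF that]
      by (simp add: algebra_simps)
    moreover have "closed {z. inner (A z) (A (c *\<^sub>C x n)) = (\<gamma> n)\<^sup>2 * inner z (c *\<^sub>C x n)}"
      by (intro closed_Collect_eq continuous_intros)
    ultimately have "N \<subseteq> {z. inner (A z) (A (c *\<^sub>C x n)) = (\<gamma> n)\<^sup>2 * inner z (c *\<^sub>C x n)}"
      unfolding N_def by (intro closure_minimal) auto
    then show ?thesis using that by blast
  qed
  have "closed_csubspace N" using N by (simp add: closed_csubspace_def N_def)
  moreover have "x 0 \<noteq> 0" using x1[of 0] by auto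
  then have "N \<noteq> {0}" using xN[of 0] by auto
  ultimately obtain z where z: "z \<in> N" "norm z = 1" "norm (A z) = restriction_norm A N"
    using AN by (auto simp: AN_ops_def norm_attaining_on_def)
  have "bdd_above ((\<lambda>x. norm (A x)) ` {x\<in>N. norm x = 1})"
    by (rule bdd_aboveI2[of _ _ b]) (use bN in force)
  then have "norm (A (x n)) \<le> restriction_norm A N" for n
    unfolding restriction_norm_def by (intro cSUP_upper) (auto simp: xN x1)
  then have "b \<le> norm (A z)"
    unfolding z(3) xA by (intro LIMSEQ_le_const2[OF \<gamma>_lim]) auto
  then have Az: "norm (A z) = b * norm z" using bN[OF z(1)] z(2) by simp
  \<comment> \<open>A norm attaining \<open>z\<close> would belong to the eigenvalue
    \<open>b\<^sup>2\<close> of the same compression, while \<open>x n\<close> belongs to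
    \<open>(\<gamma> n)\<^sup>2 < b\<^sup>2\<close>. So \<open>z\<close> is orthogonal to every
    generator, hence to the closed span that contains it.\<close>
  have zx: "inner z (c *\<^sub>C x n) = 0" for c n
  proof -
    have "c *\<^sub>C x n \<in> N" using complex_vector.subspace_scale[OF N xN] .
    then have "b\<^sup>2 * inner z (c *\<^sub>C x n) = (\<gamma> n)\<^sup>2 * inner z (c *\<^sub>C x n)"
      using norm_attained_imp_inner_eq[OF Nsub bN z(1) Az] eqN[OF z(1)] by metis
    moreover have "(\<gamma> n)\<^sup>2 < b\<^sup>2" using \<gamma>[of n] \<open>0 \<le> a\<close> by (intro power_strict_mono) auto
    ultimately show ?thesis by simp
  qed
  \<comment> \<open>Quantifying over \<open>c\<close> turns a real orthogonality condition into a
    complex subspace, as induction over the complex span requires.\<close>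
  have "\<forall>c. inner z (c *\<^sub>C y) = 0" if "y \<in> S" for y
    using that unfolding S_def
  proof (rule complex_vector.span_induct)
    show "complex_vector.subspace {y. \<forall>c. inner z (c *\<^sub>C y) = 0}"
      by (auto simp: complex_vector.subspace_def scaleC_add_right scaleC_scaleC inner_add_right)
  qed (use zx in auto)
  then have "inner z y = 0" if "y \<in> S" for y using that by (metis scaleC_one)
  moreover have "closed {y. inner z y = 0}" by (intro closed_Collect_eq continuous_intros)
  ultimately have "N \<subseteq> {y. inner z y = 0}" unfolding N_def by (intro closure_minimal) auto
  then have "inner z z = 0" using z(1) by blast
  then show False using z(2) by simp
qed

text \<open>An operator within \<open>d\<close> of \<open>T\<close> changes norms on unit vectors by
  less than \<open>d\<close>. With \<open>d\<close> a third of the gap, the approximating operator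
  still has the gap from \<open>a + d\<close> to \<open>b - d\<close>.\<close>

lemma closure_AN_ops_norm_gap:
  fixes T :: "'a::complex_hilbert \<Rightarrow>\<^sub>L 'a"
  assumes T: "T \<in> closure AN_ops" and "0 \<le> a" "a < b"
  shows "\<exists>F. finite F \<and> ((\<forall>x. norm x = 1 \<and> (\<forall>f\<in>F. inner x f = 0) \<longrightarrow> a < norm (T x)) \<or>
    (\<forall>x. norm x = 1 \<and> (\<forall>f\<in>F. inner x f = 0) \<longrightarrow> norm (T x) < b))"
proof -
  define d where "d = (b - a) / 3"
  have "d > 0" using \<open>a < b\<close> by (simp add: d_def)
  with T obtain A where A: "A \<in> AN_ops" "dist A T < d"
    unfolding closure_approachable by blast
  have near: "\<bar>norm (T x) - norm (A x)\<bar> < d" if "norm x = 1" for x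
  proof -
    have "\<bar>norm (T x) - norm (A x)\<bar> \<le> norm ((A - T) x)"
      using norm_triangle_ineq3[of "A x" "T x"] by (simp add: blinfun.diff_left abs_minus_commute)
    also have "\<dots> \<le> norm (A - T)" using norm_blinfun[of "A - T" x] that by simp
    finally show ?thesis using A(2) by (simp add: dist_norm)
  qed
  have "0 \<le> a + d" "a + d < b - d" using \<open>0 \<le> a\<close> \<open>a < b\<close> by (auto simp: d_def field_simps)
  from AN_ops_norm_gap[OF A(1) this] obtain F where "finite F" and
    F: "(\<forall>x. norm x = 1 \<and> (\<forall>f\<in>F. inner x f = 0) \<longrightarrow> a + d < norm (A x)) \<or>
    (\<forall>x. norm x = 1 \<and> (\<forall>f\<in>F. inner x f = 0) \<longrightarrow> norm (A x) < b - d)" by blast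
  from F have "(\<forall>x. norm x = 1 \<and> (\<forall>f\<in>F. inner x f = 0) \<longrightarrow> a < norm (T x)) \<or>
    (\<forall>x. norm x = 1 \<and> (\<forall>f\<in>F. inner x f = 0) \<longrightarrow> norm (T x) < b)"
    using near by (smt (verit))
  with \<open>finite F\<close> show ?thesis by blast
qed

lemma closure_AN_ops_imp_scalar_plus_compact:
  fixes T :: "'a::complex_hilbert \<Rightarrow>\<^sub>L 'a"
  assumes T: "T \<in> closure AN_ops"
  shows "\<exists>\<alpha>. scalar_plus_compact (\<lambda>x. cadjoint T (T x)) \<alpha>"
proof -
  have Tb: "T \<in> bounded_ops" using T closure_AN_ops_subset_bounded_ops by blast
  \<comment> \<open>The lower bounds of \<open>norm (T x)\<close> that hold far out. The cap
    \<open>norm T\<close> keeps the set bounded in finite dimension, where a spanning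
    \<open>F\<close> makes the last condition vacuous.\<close>
  define D where "D = {a. 0 \<le> a \<and> a \<le> norm T \<and>
    (\<exists>F. finite F \<and> (\<forall>x. norm x = 1 \<and> (\<forall>f\<in>F. inner x f = 0) \<longrightarrow> a \<le> norm (T x)))}"
  have D0: "0 \<in> D" by (auto simp: D_def)
  have bdd: "bdd_above D" by (rule bdd_aboveI[of _ "norm T"]) (simp add: D_def)
  define s where "s = Sup D"
  have "0 \<le> s" unfolding s_def by (rule cSup_upper[OF D0 bdd])
  moreover have "s \<le> norm T"
    unfolding s_def by (rule cSup_least) (use D0 in blast, simp add: D_def)
  ultimately have s: "0 \<le> s" "s \<le> norm T" by blast+
  have lower: "\<exists>F. finite F \<and> (\<forall>x. norm x = 1 \<and> (\<forall>f\<in>F. inner x f = 0) \<longrightarrow> s - d \<le> norm (T x))"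
    if "d > 0" for d
  proof -
    have "s - d < Sup D" using that by (simp add: s_def)
    then obtain a where "a \<in> D" "s - d < a" using less_cSupD[of D] D0 by blast
    then obtain F where "finite F" "\<forall>x. norm x = 1 \<and> (\<forall>f\<in>F. inner x f = 0) \<longrightarrow> a \<le> norm (T x)"
      by (auto simp: D_def)
    with \<open>s - d < a\<close> show ?thesis by (intro exI[of _ F]) force
  qed
  have upper: "\<exists>F. finite F \<and> (\<forall>x. norm x = 1 \<and> (\<forall>f\<in>F. inner x f = 0) \<longrightarrow> norm (T x) \<le> s + d)"
    if "d > 0" for d
  proof (cases "s + d \<ge> norm T")
    case True
    have "norm (T x) \<le> s + d" if "norm x = 1" for x
      using norm_blinfun[of T x] that True by simp
    then show ?thesis by (intro exI[of _ "{}"]) auto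
  next
    case False
    have "0 \<le> s + d / 2" "s + d / 2 < s + d" using s that by auto
    from closure_AN_ops_norm_gap[OF T this] obtain F where F: "finite F"
      "(\<forall>x. norm x = 1 \<and> (\<forall>f\<in>F. inner x f = 0) \<longrightarrow> s + d / 2 < norm (T x)) \<or>
       (\<forall>x. norm x = 1 \<and> (\<forall>f\<in>F. inner x f = 0) \<longrightarrow> norm (T x) < s + d)" by blast
    \<comment> \<open>Otherwise \<open>s + d / 2\<close> would be a member of \<open>D\<close> above
      its supremum; in the present case it respects the cap \<open>norm T\<close>.\<close>
    have "\<not> (\<forall>x. norm x = 1 \<and> (\<forall>f\<in>F. inner x f = 0) \<longrightarrow> s + d / 2 < norm (T x))"
    proof
      assume "\<forall>x. norm x = 1 \<and> (\<forall>f\<in>F. inner x f = 0) \<longrightarrow> s + d / 2 < norm (T x)"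
      then have "s + d / 2 \<in> D"
        using F(1) False s that by (auto simp: D_def intro!: exI[of _ F] less_imp_le)
      from cSup_upper[OF this bdd] show False using that by (simp add: s_def)
    qed
    with F show ?thesis by (intro exI[of _ F]) (auto intro: less_imp_le)
  qed
  have inner_P: "inner (cadjoint T (T x)) y = inner (T x) (T y)" for x y
    using inner_cadjoint[OF Tb, of y "T x"] by (simp add: inner_commute)
  have "scalar_plus_compact (\<lambda>x. cadjoint T (T x)) (s\<^sup>2)"
  proof (rule scalar_plus_compact.intro)
    show "bounded_linear (\<lambda>x. cadjoint T (T x))"
      by (intro bounded_linear_compose[OF blinfun.bounded_linear_right blinfun.bounded_linear_right])
    show "inner (cadjoint T (T x)) y = inner x (cadjoint T (T y))" for x y
      by (simp add: inner_P inner_cadjoint[OF Tb, symmetric])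
    fix \<epsilon> :: real assume "\<epsilon> > 0"
    \<comment> \<open>A deviation of \<open>norm (T u)\<close> from \<open>s\<close> by
      \<open>d\<close> changes the square by at most \<open>d * (2 * norm T)\<close>. The summand 1
      covers \<open>T = 0\<close>.\<close>
    define d where "d = \<epsilon> / (2 * norm T + 1)"
    have d: "d > 0" "d * (2 * norm T) \<le> \<epsilon>"
    proof -
      have "2 * norm T + 1 > 0" by (simp add: add_nonneg_pos)
      then show "d > 0" using \<open>\<epsilon> > 0\<close> by (simp add: d_def)
      have "d * (2 * norm T + 1) = \<epsilon>" using \<open>2 * norm T + 1 > 0\<close> by (simp add: d_def)
      then show "d * (2 * norm T) \<le> \<epsilon>" using \<open>d > 0\<close> by (simp add: distrib_left)
    qed
    obtain F where F: "finite F" "\<And>x. norm x = 1 \<Longrightarrow> \<forall>f\<in>F. inner x f = 0 \<Longrightarrow> s - d \<le> norm (T x)"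
      using lower[OF d(1)] by blast
    obtain G where G: "finite G" "\<And>x. norm x = 1 \<Longrightarrow> \<forall>f\<in>G. inner x f = 0 \<Longrightarrow> norm (T x) \<le> s + d"
      using upper[OF d(1)] by blast
    have unit: "\<bar>(norm (T u))\<^sup>2 - s\<^sup>2\<bar> \<le> \<epsilon>" if u: "norm u = 1" "\<forall>f\<in>F \<union> G. inner u f = 0" for u
    proof -
      have "norm (T u) \<le> norm T" using norm_blinfun[of T u] u by simp
      have "\<bar>(norm (T u))\<^sup>2 - s\<^sup>2\<bar> = \<bar>norm (T u) - s\<bar> * (norm (T u) + s)"
        using s by (simp add: power2_eq_square square_diff_square_factored abs_mult)
      also have "\<dots> \<le> d * (2 * norm T)"
        using F(2)[of u] G(2)[of u] u s \<open>norm (T u) \<le> norm T\<close> by (intro mult_mono) auto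
      finally show ?thesis using d(2) by simp
    qed
    have "\<bar>inner (cadjoint T (T x)) x - s\<^sup>2 * (norm x)\<^sup>2\<bar> \<le> \<epsilon> * (norm x)\<^sup>2"
      if x: "\<forall>f\<in>F \<union> G. inner x f = 0" for x
    proof (cases "x = 0")
      case False
      have "\<forall>f\<in>F \<union> G. inner (sgn x) f = 0" using x by (simp add: sgn_div_norm)
      then have "\<bar>(norm (T (sgn x)))\<^sup>2 - s\<^sup>2\<bar> \<le> \<epsilon>" using False by (intro unit) (simp add: norm_sgn)
      then have "\<bar>(norm (T (sgn x)))\<^sup>2 - s\<^sup>2\<bar> * (norm x)\<^sup>2 \<le> \<epsilon> * (norm x)\<^sup>2"
        by (rule mult_right_mono) simp
      also have "\<bar>(norm (T (sgn x)))\<^sup>2 - s\<^sup>2\<bar> * (norm x)\<^sup>2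
          = \<bar>((norm (T (sgn x)))\<^sup>2 - s\<^sup>2) * (norm x)\<^sup>2\<bar>" by (simp add: abs_mult)
      also have "((norm (T (sgn x)))\<^sup>2 - s\<^sup>2) * (norm x)\<^sup>2
          = inner (cadjoint T (T x)) x - s\<^sup>2 * (norm x)\<^sup>2"
        using False by (simp add: inner_P dot_square_norm sgn_div_norm blinfun.scaleR_right
            power_divide field_simps)
      finally show ?thesis .
    qed simp
    then show "\<exists>F. finite F \<and> (\<forall>x. (\<forall>f\<in>F. inner x f = 0) \<longrightarrow>
        \<bar>inner (cadjoint T (T x)) x - s\<^sup>2 * (norm x)\<^sup>2\<bar> \<le> \<epsilon> * (norm x)\<^sup>2)"
      using F(1) G(1) by (intro exI[of _ "F \<union> G"]) auto
  qed
  then show ?thesis by blast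
qed

section \<open>Orthogonal direct sums and the positive square root\<close>

text \<open>The factor 2 comes from estimating real and imaginary part separately by the real
  Cauchy-Schwarz inequality.\<close>

lemma bounded_linear_cinner_left: "bounded_linear (\<lambda>x. cinner x y)"
proof (rule bounded_linear_intro[of _ "2 * norm y"])
  show "cinner (x + z) y = cinner x y + cinner z y" for x z by (rule cinner_add_left)
  show "cinner (r *\<^sub>R x) y = r *\<^sub>R cinner x y" for r x
    by (simp add: scaleR_scaleC cinner_scaleC_left scaleR_conv_of_real)
  show "norm (cinner x y) \<le> norm x * (2 * norm y)" for x
  proof -
    have "cmod (cinner x y) \<le> \<bar>inner x y\<bar> + \<bar>inner x (\<i> *\<^sub>C y)\<bar>"
      using cmod_le[of "cinner x y"] by (simp add: cinner_eq_Complex_inner)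
    also have "\<dots> \<le> norm x * norm y + norm x * norm (\<i> *\<^sub>C y)"
      by (intro add_mono Cauchy_Schwarz_ineq2)
    finally show ?thesis by (simp add: norm_scaleC)
  qed
qed

lemma
  assumes H: "orthogonal_direct_sum H" and y: "\<And>n. y n \<in> H n" "y sums x"
  shows orthogonal_direct_sum_inner: "w \<in> H n \<Longrightarrow> inner x w = inner (y n) w"
    and orthogonal_direct_sum_cinner: "cinner (y n) x = complex_of_real ((norm (y n))\<^sup>2)"
proof -
  have orth: "cinner u w = 0" if "u \<in> H m" "w \<in> H n" "m \<noteq> n" for u w m n
    using H that by (auto simp: orthogonal_direct_sum_def)
  then have orth': "inner u w = 0" if "u \<in> H m" "w \<in> H n" "m \<noteq> n" for u w m n
    using that by (auto simp: inner_eq_Re_cinner)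
  show *: "inner x w = inner (y n) w" if "w \<in> H n" for w n
    using orth' y(1) that by (intro inner_orthogonal_series[OF _ y(2)]) blast
  have "complex_vector.subspace (H n)"
    using H unfolding orthogonal_direct_sum_def closed_csubspace_def by blast
  \<comment> \<open>Testing with \<open>y n\<close> gives the real part of
    \<open>cinner x (y n)\<close>, testing with its multiple by \<i> the imaginary part.\<close>
  then have "\<i> *\<^sub>C y n \<in> H n" using y(1) by (rule complex_vector.subspace_scale)
  then have "cinner x (y n) = cinner (y n) (y n)"
    using * y(1) by (simp add: cinner_eq_Complex_inner)
  then show "cinner (y n) x = complex_of_real ((norm (y n))\<^sup>2)"
    by (subst cinner_commute) (simp add: cinner_self)
qed

lemma orthogonal_direct_sum_unique:
  assumes H: "orthogonal_direct_sum H" and y: "\<And>n. y n \<in> H n" "y sums x"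
    and z: "\<And>n. z n \<in> H n" "z sums x"
  shows "y n = z n"
proof -
  have "complex_vector.subspace (H n)"
    using H unfolding orthogonal_direct_sum_def closed_csubspace_def by blast
  then have "y n - z n \<in> H n" using y(1) z(1) by (intro complex_vector.subspace_diff)
  then have "inner (y n) (y n - z n) = inner (z n) (y n - z n)"
    using orthogonal_direct_sum_inner[OF H y] orthogonal_direct_sum_inner[OF H z] by metis
  then have "inner (y n - z n) (y n - z n) = 0" by (simp add: inner_diff_left)
  then show ?thesis by simp
qed

lemma orthogonal_direct_sum_blinfun_eqI:
  fixes S R :: "'a::complex_hilbert \<Rightarrow>\<^sub>L 'a"
  assumes H: "orthogonal_direct_sum H" and eq: "\<And>n y. y \<in> H n \<Longrightarrow> S y = R y"
  shows "S = R"
proof (rule blinfun_eqI)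
  fix x
  obtain y where y: "\<And>n. y n \<in> H n" "y sums x"
    using H unfolding orthogonal_direct_sum_def by blast
  have "(\<lambda>n. S (y n)) sums S x" "(\<lambda>n. R (y n)) sums R x"
    using y(2) by (rule bounded_linear.sums[OF blinfun.bounded_linear_right])+
  then show "S x = R x" using eq[OF y(1)] by (simp add: sums_unique2)
qed

text \<open>Supplies the candidate for the absolute value. It is defined by scaling components;
  uniqueness of components makes it linear, and boundedness of \<open>c\<close> gives convergence
  and the norm bound.\<close>

lemma diagonal_positive_op_exists:
  fixes H :: "nat \<Rightarrow> 'a::complex_hilbert set"
  assumes H: "orthogonal_direct_sum H" and c: "\<And>n. 0 \<le> c n" "\<And>n. c n \<le> C"
  shows "\<exists>S. positive_op S \<and> (\<forall>n. \<forall>y\<in>H n. S y = c n *\<^sub>R y)"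
proof -
  have sub: "complex_vector.subspace (H n)" for n
    using H unfolding orthogonal_direct_sum_def closed_csubspace_def by blast
  have "\<exists>y. (\<forall>n. y n \<in> H n) \<and> y sums x" for x
    using H unfolding orthogonal_direct_sum_def by blast
  then obtain Y where YH: "\<And>x n. Y x n \<in> H n" and Y: "\<And>x. Y x sums x" by metis
  have uniq: "Y x = y" if "\<And>n. y n \<in> H n" "y sums x" for x y
    using orthogonal_direct_sum_unique[OF H YH Y that] by auto
  have Yorth: "inner (Y x m) (Y x n) = 0" if "m \<noteq> n" for x m n
    using H YH that by (simp add: orthogonal_direct_sum_def inner_eq_Re_cinner)
  then have orth: "inner (c m *\<^sub>R Y x m) (c n *\<^sub>R Y x n) = 0" if "m \<noteq> n" for x m n
    using that by simp
  have Ysq: "(\<lambda>n. (norm (Y x n))\<^sup>2) sums (norm x)\<^sup>2" for x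
    by (rule norm_sq_sums_orthogonal[OF Yorth Y])
  have le: "(norm (c n *\<^sub>R Y x n))\<^sup>2 \<le> C\<^sup>2 * (norm (Y x n))\<^sup>2" for x n
    using c[of n] by (simp add: power_mult_distrib mult_right_mono power_mono)
  define S where "S x = (\<Sum>n. c n *\<^sub>R Y x n)" for x
  have S: "(\<lambda>n. c n *\<^sub>R Y x n) sums S x" for x
    unfolding S_def
  proof (rule summable_sums[OF summable_orthogonal[OF orth]])
    show "summable (\<lambda>n. (norm (c n *\<^sub>R Y x n))\<^sup>2)"
      by (rule summable_comparison_test'[OF summable_mult[OF sums_summable[OF Ysq], of "C\<^sup>2"], where N = 0])
        (unfold real_norm_def abs_power2, rule le)
  qed
  have SC: "S (a *\<^sub>C x) = a *\<^sub>C S x" for a x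
  proof -
    have "Y (a *\<^sub>C x) = (\<lambda>n. a *\<^sub>C Y x n)"
      by (intro uniq complex_vector.subspace_scale[OF sub YH]
          bounded_linear.sums[OF bounded_linear_scaleC Y])
    then have "(\<lambda>n. a *\<^sub>C c n *\<^sub>R Y x n) sums S (a *\<^sub>C x)"
      using S[of "a *\<^sub>C x"] by (simp add: scaleC_scaleR_commute)
    then show ?thesis
      using bounded_linear.sums[OF bounded_linear_scaleC S] sums_unique2 by blast
  qed
  have "bounded_linear S"
  proof (rule bounded_linear_intro[of _ C])
    show "S (x + z) = S x + S z" for x z
    proof -
      have "Y (x + z) = (\<lambda>n. Y x n + Y z n)"
        by (intro uniq complex_vector.subspace_add[OF sub YH YH] sums_add Y)
      then have "(\<lambda>n. c n *\<^sub>R Y x n + c n *\<^sub>R Y z n) sums S (x + z)"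
        using S[of "x + z"] by (simp add: scaleR_add_right)
      then show ?thesis using sums_add[OF S S] sums_unique2 by blast
    qed
    show "S (r *\<^sub>R x) = r *\<^sub>R S x" for r x by (simp add: scaleR_scaleC SC)
    show "norm (S x) \<le> norm x * C" for x
    proof (rule power2_le_imp_le)
      have "(norm (S x))\<^sup>2 \<le> C\<^sup>2 * (norm x)\<^sup>2"
        by (rule sums_le[OF le norm_sq_sums_orthogonal[OF orth S] sums_mult[OF Ysq]])
      then show "(norm (S x))\<^sup>2 \<le> (norm x * C)\<^sup>2" by (simp add: power_mult_distrib mult.commute)
      show "0 \<le> norm x * C" using c[of 0] by simp
    qed
  qed
  then have app: "blinfun_apply (Blinfun S) = S" by (rule bounded_linear_Blinfun_apply)
  have "cinner (S x) x \<in> \<real> \<and> 0 \<le> Re (cinner (S x) x)" for x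
  proof -
    have "(\<lambda>n. cinner (c n *\<^sub>R Y x n) x) sums cinner (S x) x"
      by (rule bounded_linear.sums[OF bounded_linear_cinner_left S])
    then have sums: "(\<lambda>n. complex_of_real (c n * (norm (Y x n))\<^sup>2)) sums cinner (S x) x"
      by (simp add: scaleR_scaleC cinner_scaleC_left orthogonal_direct_sum_cinner[OF H YH Y])
    have "0 \<le> Re (cinner (S x) x)"
      by (rule sums_le[OF _ sums_zero sums_Re[OF sums]]) (simp add: c)
    moreover have "Im (cinner (S x) x) = 0"
      using sums_Im[OF sums] sums_unique2[OF _ sums_zero] by simp
    ultimately show ?thesis by (simp add: complex_is_Real_iff)
  qed
  then have "positive_op (Blinfun S)" by (simp add: positive_op_def bounded_ops_def app SC)
  moreover have "S y = c n *\<^sub>R y" if "y \<in> H n" for n y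
  proof -
    have "Y y = (\<lambda>m. if m = n then y else 0)"
      using that complex_vector.subspace_0[OF sub]
      by (intro uniq) (auto intro: sums_single[of n "\<lambda>_. y"])
    then have "(\<lambda>m. if m = n then c m *\<^sub>R y else 0) sums S y"
      using S[of y] by (simp add: if_distrib cong: if_cong)
    then show ?thesis using sums_single[of n "\<lambda>m. c m *\<^sub>R y"] sums_unique2 by blast
  qed
  ultimately show ?thesis using app by auto
qed

text \<open>The vector \<open>w = S y - c *\<^sub>R y\<close> satisfies
  \<open>S w = - c *\<^sub>R w\<close>, which contradicts positivity for \<open>c > 0\<close> unless
  \<open>w = 0\<close>. For \<open>c = 0\<close> the form along \<open>y + t *\<^sub>R w\<close> is
  affine in \<open>t\<close> with slope \<open>(norm w)\<^sup>2\<close>, so it stays nonnegative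
  only if \<open>w = 0\<close>.\<close>

lemma positive_sqrt_eigenvector:
  fixes S :: "'a::complex_hilbert \<Rightarrow>\<^sub>L 'a"
  assumes S: "positive_op S" and SS: "S (S y) = c\<^sup>2 *\<^sub>R y" and c: "0 \<le> c"
  shows "S y = c *\<^sub>R y"
proof (cases "c = 0")
  case True
  define w where "w = S y"
  have Sw: "S w = 0" using SS True by (simp add: w_def)
  have *: "0 \<le> inner w y + t * (norm w)\<^sup>2" for t
  proof -
    have "0 \<le> inner (S (y + t *\<^sub>R w)) (y + t *\<^sub>R w)"
      using S unfolding positive_op_def inner_eq_Re_cinner by blast
    then show ?thesis
      by (simp add: blinfun.add_right blinfun.scaleR_right Sw w_def[symmetric] inner_add_right
          dot_square_norm)
  qed
  have "w = 0"
  proof (rule ccontr)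
    assume "w \<noteq> 0"
    then have "inner w y + (- (inner w y + 1) / (norm w)\<^sup>2) * (norm w)\<^sup>2 = - 1" by simp
    with *[of "- (inner w y + 1) / (norm w)\<^sup>2"] show False by simp
  qed
  then show ?thesis using True by (simp add: w_def)
next
  case False
  define w where "w = S y - c *\<^sub>R y"
  have "S w = - c *\<^sub>R w"
    by (simp add: w_def blinfun.diff_right blinfun.scaleR_right SS power2_eq_square algebra_simps)
  then have "inner (S w) w = - c * (norm w)\<^sup>2" by (simp add: dot_square_norm)
  moreover have "0 \<le> inner (S w) w"
    using S unfolding positive_op_def inner_eq_Re_cinner by blast
  ultimately have "c * (norm w)\<^sup>2 \<le> 0" by simp
  then have "w = 0" using False c by (simp add: mult_le_0_iff)
  then show ?thesis by (simp add: w_def)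
qed

text \<open>The diagonal operator with entries \<open>c n\<close> is a positive square root, and any
  other one agrees with it on every summand. This resolves the definite description without a
  general square root theorem.\<close>

lemma abs_op_on_orthogonal_direct_sum:
  fixes T :: "'a::complex_hilbert \<Rightarrow>\<^sub>L 'a"
  assumes H: "orthogonal_direct_sum H" and c: "\<And>n. 0 \<le> c n" "\<And>n. c n \<le> C"
    and T: "\<And>n y. y \<in> H n \<Longrightarrow> cadjoint T (T y) = (c n)\<^sup>2 *\<^sub>R y"
    and y: "y \<in> H n"
  shows "abs_op T y = c n *\<^sub>R y"
proof -
  obtain S where S: "positive_op S" "\<And>n y. y \<in> H n \<Longrightarrow> S y = c n *\<^sub>R y"
    using diagonal_positive_op_exists[OF H, of c C, OF c] by blast
  have "abs_op T = S"
    unfolding abs_op_def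
  proof (rule the_equality)
    have "S o\<^sub>L S = cadjoint T o\<^sub>L T"
      using S(2) T by (intro orthogonal_direct_sum_blinfun_eqI[OF H])
        (simp add: blinfun.scaleR_right power2_eq_square)
    then show "positive_op S \<and> S o\<^sub>L S = cadjoint T o\<^sub>L T" using S(1) by blast
    fix R assume R: "positive_op R \<and> R o\<^sub>L R = cadjoint T o\<^sub>L T"
    have RR: "R (R y) = cadjoint T (T y)" for y
      using arg_cong[OF conjunct2[OF R], of "\<lambda>A. blinfun_apply A y"] by simp
    show "R = S"
    proof (rule orthogonal_direct_sum_blinfun_eqI[OF H])
      fix n y assume "y \<in> H n"
      then have "R (R y) = (c n)\<^sup>2 *\<^sub>R y" using RR T by simp
      then show "R y = S y"
        using positive_sqrt_eigenvector R c(1) S(2)[OF \<open>y \<in> H n\<close>] by metis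
    qed
  qed
  then show ?thesis using S(2)[OF y] by simp
qed

section \<open>The decomposition along the eigenspaces of \<open>T\<^sup>*T\<close>\<close>

lemma eigenvalue_in_op_spectrum:
  fixes S :: "'a::complex_hilbert \<Rightarrow>\<^sub>L 'a"
  assumes "S x = \<mu> *\<^sub>C x" "x \<noteq> 0"
  shows "\<mu> \<in> op_spectrum S"
proof -
  have False if "\<And>x. blinfun_apply R (S x - \<mu> *\<^sub>C x) = x" for R
    using that[of x] assms by simp
  then show ?thesis unfolding op_spectrum_def by blast
qed

theorem theorem5p5:
  fixes T :: "'a::complex_hilbert \<Rightarrow>\<^sub>L 'a"
  assumes "\<exists>x::'a. x \<noteq> 0"
    and "T \<in> closure AN_ops"
    and "normal_op T"
  shows "\<exists>(H :: nat \<Rightarrow> 'a set) (U :: nat \<Rightarrow> 'a \<Rightarrow> 'a) (l :: nat \<Rightarrow> complex).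
    (\<forall>n. reducing_subspace T (H n) \<and> unitary_on (H n) (U n) \<and> l n \<in> op_spectrum (abs_op T)) \<and>
    orthogonal_direct_sum H \<and>
    is_direct_sum_op T H (\<lambda>n x. l n *\<^sub>C U n x)"
proof -
  have T: "T \<in> bounded_ops" using assms(2) closure_AN_ops_subset_bounded_ops by blast
  note T' = cadjoint_bounded_ops[OF T]
  note scale = bounded_ops_scaleC[OF T] bounded_ops_scaleC[OF T']
  have normal: "cadjoint T (T x) = T (cadjoint T x)" for x
    using arg_cong[OF assms(3)[unfolded normal_op_def], of "\<lambda>A. blinfun_apply A x"] by simp
  obtain \<alpha> where \<alpha>: "scalar_plus_compact (\<lambda>x. cadjoint T (T x)) \<alpha>"
    using closure_AN_ops_imp_scalar_plus_compact[OF assms(2)] by blast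
  obtain g where g: "inj g"
    "\<And>x. \<exists>y. (\<forall>n. cadjoint T (T (y n)) = g n *\<^sub>R y n) \<and> y sums x"
    using scalar_plus_compact.eigenvector_expansion[OF \<alpha>] by blast
  define H where "H n = {x. cadjoint T (T x) = g n *\<^sub>R x}" for n
  have Hsub: "complex_vector.subspace (H n)" for n
    by (auto simp: H_def complex_vector.subspace_def blinfun.add_right scale
        scaleR_add_right scaleC_scaleR_commute)
  have "closed (H n)" for n
    unfolding H_def by (intro closed_Collect_eq continuous_intros)
  with Hsub have Hcl: "closed_csubspace (H n)" for n by (simp add: closed_csubspace_def)
  have orth: "inner x y = 0" if "x \<in> H m" "y \<in> H n" "m \<noteq> n" for x y m n
    using symmetric_op_eigenvectors_orthogonal[of "\<lambda>x. cadjoint T (T x)" x y "g m" "g n",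
        OF scalar_plus_compact.sym[OF \<alpha>]] g(1) that by (simp add: H_def inj_eq)
  then have "cinner x y = 0" if "x \<in> H m" "y \<in> H n" "m \<noteq> n" for x y m n
    unfolding cinner_eq_0_iff
    using orth[OF that] orth[OF that(1) complex_vector.subspace_scale[OF Hsub that(2)] that(3)] by blast
  moreover have "\<exists>y. (\<forall>n. y n \<in> H n) \<and> y sums x" for x
    using g(2)[of x] by (simp add: H_def)
  ultimately have H: "orthogonal_direct_sum H" using Hcl by (simp add: orthogonal_direct_sum_def)
  have normT: "(norm (T x))\<^sup>2 = g n * (norm x)\<^sup>2" if "x \<in> H n" for x n
  proof -
    have "(norm (T x))\<^sup>2 = inner x (cadjoint T (T x))"
      by (simp add: inner_cadjoint[OF T, symmetric] dot_square_norm)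
    then show ?thesis using that by (simp add: H_def dot_square_norm)
  qed
  \<comment> \<open>On a trivial summand \<open>g n\<close> is just a label, possibly larger than
    \<open>(norm T)\<^sup>2\<close>; the value 0 keeps \<open>c\<close> within the bounds that the
    diagonal operator requires.\<close>
  define c where "c n = (if H n = {0} then 0 else sqrt (g n))" for n
  have g0: "0 \<le> g n" "g n \<le> (norm T)\<^sup>2" if ne: "H n \<noteq> {0}" for n
  proof -
    from ne obtain x where x: "x \<in> H n" "x \<noteq> 0"
      using complex_vector.subspace_0[OF Hsub] by blast
    have "0 \<le> g n * (norm x)\<^sup>2" using normT[OF x(1)] by (metis zero_le_power2)
    then show "0 \<le> g n" using x(2) by (simp add: zero_le_mult_iff)
    have "g n * (norm x)\<^sup>2 \<le> (norm T)\<^sup>2 * (norm x)\<^sup>2"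
      using normT[OF x(1)] power_mono[OF norm_blinfun[of T x], of 2] by (simp add: power_mult_distrib)
    then show "g n \<le> (norm T)\<^sup>2" using x(2) by simp
  qed
  have c: "0 \<le> c n" "c n \<le> norm T" for n
    using g0[of n] by (auto simp: c_def real_le_lsqrt)
  have Pc: "cadjoint T (T y) = (c n)\<^sup>2 *\<^sub>R y" if "y \<in> H n" for y n
    using that g0(1)[of n] by (cases "H n = {0}") (auto simp: c_def H_def)
  have abs: "abs_op T y = complex_of_real (c n) *\<^sub>C y" if "y \<in> H n" for y n
    using abs_op_on_orthogonal_direct_sum[where c = c and C = "norm T", OF H c Pc that] by (simp add: scaleR_scaleC)
  have spec: "complex_of_real (c n) \<in> op_spectrum (abs_op T)" if ne: "H n \<noteq> {0}" for n
  proof -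
    from ne obtain x where "x \<in> H n" "x \<noteq> 0"
      using complex_vector.subspace_0[OF Hsub] by blast
    then show ?thesis using abs eigenvalue_in_op_spectrum by blast
  qed
  obtain k where k: "H k \<noteq> {0}"
  proof -
    obtain x :: 'a where "x \<noteq> 0" using assms(1) by blast
    obtain y where y: "\<And>n. y n \<in> H n" "y sums x"
      using H unfolding orthogonal_direct_sum_def by blast
    have "\<not> (\<forall>n. H n = {0})"
    proof
      assume "\<forall>n. H n = {0}"
      then have "y = (\<lambda>n. 0)" using y(1) by auto
      then show False using y(2) sums_unique2[OF _ sums_zero] \<open>x \<noteq> 0\<close> by blast
    qed
    then show ?thesis using that by blast
  qed
  \<comment> \<open>On a trivial summand \<open>c n\<close> need not be in the spectrum, so the
    value of the nonzero summand \<open>H k\<close> is used.\<close>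
  define l where "l n = complex_of_real (if H n = {0} then c k else c n)" for n
  \<comment> \<open>Where \<open>c n = 0\<close>, \<open>T\<close> vanishes on \<open>H n\<close>,
    and the identity serves as the unitary factor.\<close>
  define U where "U n x = (if c n = 0 then x else complex_of_real (inverse (c n)) *\<^sub>C T x)" for n x
  \<comment> \<open>By normality both \<open>T\<close> and its adjoint commute with
    \<open>T\<^sup>*T\<close>, so they preserve its eigenspaces.\<close>
  have TH: "T x \<in> H n" and T'H: "cadjoint T x \<in> H n" if "x \<in> H n" for x n
    using that by (simp_all add: H_def normal[symmetric] blinfun.scaleR_right)
      (simp_all add: normal blinfun.scaleR_right)
  \<comment> \<open>Invariance of \<open>H n\<close> under the adjoint becomes invariance of the
    orthogonal complement under \<open>T\<close>.\<close>
  have "reducing_subspace T (H n)" for n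
    using Hcl TH T'H
    by (auto simp: reducing_subspace_def corthogonal_complement_def cinner_cadjoint[OF T])
  moreover have "unitary_on (H n) (U n)" for n
  proof (cases "c n = 0")
    case True
    have "bounded_op_on (H n) (\<lambda>x. x)"
      unfolding bounded_op_on_def by (auto intro: exI[of _ 1])
    moreover have "U n = (\<lambda>x. x)" using True by (simp add: U_def fun_eq_iff)
    ultimately show ?thesis by (auto simp: unitary_on_def)
  next
    case False
    have bop: "bounded_op_on (H n) (\<lambda>x. complex_of_real r *\<^sub>C S x)"
      if S: "S \<in> bounded_ops" "\<And>x. x \<in> H n \<Longrightarrow> S x \<in> H n" for S :: "'a \<Rightarrow>\<^sub>L 'a" and r
      unfolding bounded_op_on_def
    proof (intro conjI allI ballI exI)
      show "(\<lambda>x. complex_of_real r *\<^sub>C S x) ` H n \<subseteq> H n"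
        using S(2) complex_vector.subspace_scale[OF Hsub] by blast
      show "norm (complex_of_real r *\<^sub>C S x) \<le> (\<bar>r\<bar> * norm S) * norm x" for x
        using mult_left_mono[OF norm_blinfun[of S x], of "\<bar>r\<bar>"] by (simp add: norm_scaleC)
    qed (simp_all add: blinfun.add_right scaleC_add_right bounded_ops_scaleC[OF S(1)]
        scaleC_scaleC mult.commute)
    \<comment> \<open>On \<open>H n\<close> the product of \<open>V\<close> and \<open>U n\<close>
      in one order is \<open>T\<^sup>*T\<close> divided by \<open>(c n)\<^sup>2\<close>, that is the
      identity; normality gives the other order.\<close>
    define V where "V x = complex_of_real (inverse (c n)) *\<^sub>C cadjoint T x" for x
    have U: "U n = (\<lambda>x. complex_of_real (inverse (c n)) *\<^sub>C T x)" using False by (auto simp: U_def)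
    have "bounded_op_on (H n) (U n)" unfolding U by (rule bop[OF T TH])
    moreover have "bounded_op_on (H n) V" unfolding V_def by (rule bop[OF T' T'H])
    moreover have "cinner (U n x) y = cinner x (V y)" for x y
      by (simp add: U V_def cinner_scaleC_left cinner_scaleC_right cinner_cadjoint[OF T])
    moreover have "inverse (c n) * (inverse (c n) * (c n * c n)) = 1"
      using False by (simp add: field_simps)
    then have "V (U n x) = x \<and> U n (V x) = x" if "x \<in> H n" for x
      using Pc[OF that] False unfolding U V_def scaleR_scaleC[symmetric]
      by (simp add: blinfun.scaleR_right normal[symmetric] power2_eq_square)
    ultimately show ?thesis unfolding unitary_on_def by blast
  qed
  moreover have "l n \<in> op_spectrum (abs_op T)" for n
    using spec k by (simp add: l_def)
  moreover have lU: "l n *\<^sub>C U n x = T x" if "x \<in> H n" for n x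
  proof (cases "c n = 0")
    case True
    then have "(norm (T x))\<^sup>2 = 0"
      using Pc[OF that] inner_cadjoint[OF T, of x "T x"] by (simp add: dot_square_norm)
    then have "T x = 0" by simp
    moreover have "x = 0 \<or> l n = 0" using True that by (auto simp: l_def)
    ultimately show ?thesis using True by (auto simp: U_def)
  next
    case False
    then have "H n \<noteq> {0}" unfolding c_def by meson
    then have "l n = complex_of_real (c n)" by (simp add: l_def)
    moreover have "U n x = inverse (c n) *\<^sub>R T x" using False by (simp add: U_def scaleR_scaleC)
    ultimately show ?thesis using False by (simp add: scaleR_scaleC[symmetric])
  qed
  have "is_direct_sum_op T H (\<lambda>n x. l n *\<^sub>C U n x)"
    unfolding is_direct_sum_op_def
  proof (intro allI impI)
    fix x y assume y: "(\<forall>n. y n \<in> H n) \<and> y sums x"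
    then have "(\<lambda>n. T (y n)) sums T x"
      using bounded_linear.sums[OF blinfun.bounded_linear_right] by blast
    then show "(\<lambda>n. l n *\<^sub>C U n (y n)) sums T x" using y lU by simp
  qed
  ultimately show ?thesis using H by blast
qed

end
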